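(* Let $\ell\in\mathbb{N}$ and let $G=([n],\mathcal{E})$ be a graph. Suppose the problem $$\text{(SDP)}\qquad \min\{\langle A_0,X\rangle:\ b_i^l\le\langle A_i,X\rangle\le b_i^u\ \ \forall i\in[m],\ X\in\mathbb{S}^n_+\}$$ has $(G,\ell)$-SPLR structure. Let $(T,\mathcal{V})$ be a tree decomposition of $G$ with $|T|=p$ and width $\mathrm{wid}(T,\mathcal{V})=\mathrm{tw}(G)$. Then (SDP) has an extension (SDPex), of the explicit form (E) described in the context, with sparsity pattern $\widehat{G}=([\widehat{n}],\widehat{\mathcal{E}})$ such that $$\widehat{n}\le n+2p\,\ell\quad\text{and}\quad \mathrm{tw}(\widehat{G})\le \mathrm{tw}(G)+3\ell .$$ Moreover, if $T$ is a path and $\mathrm{tw}(G)=\mathrm{pw}(G)$, then the bounds can be strengthened to $\widehat{n}\le n+p\,\ell$ and $\mathrm{tw}(\widehat{G})\le \mathrm{tw}(G)+2\ell$.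
   Context: Notation. $\mathbb{N}=\{0,1,2,\dots\}$; $[n]=\{1,\dots,n\}$; $\mathbb{S}^n$ is the space of real symmetric $n\times n$ matrices with trace inner product $\langle\cdot,\cdot\rangle$, and $\mathbb{S}^n_+$ its positive semidefinite cone. Graphs are simple and undirected. $X_{I,J}$ is the submatrix of $X$ with rows $I$ and columns $J$. For a graph $G=([n],\mathcal{E})$, $\mathbb{S}^n(\mathcal{E},0)=\{X\in\mathbb{S}^n: X_{ij}=X_{ji}=0 \text{ whenever } i\ne j,\ ij\notin\mathcal{E}\}$. SDP data. In (SDP), $A_i\in\mathbb{S}^n$ for $i\in\{0,1,\dots,m\}$ and $-\infty\le b_i^l\le b_i^u<+\infty$ for $i\in[m]$. A graph $([n],\mathcal{E})$ is a sparsity pattern of (SDP) if $A_i\in\mathbb{S}^n(\mathcal{E},0)$ for all $i\in\{0,\dots,m\}$ (and likewise for any other linear SDP). SPLR structure. (SDP) has $(G,\ell)$-SPLR (sparse plus low-rank) structure if there exist decompositions $A_i=A_i^s+A_i^l$ with $A_i^s\in\mathbb{S}^n(\mathcal{E},0)$ for all $i\in\{0,\dots,m\}$ and $\mathrm{rank}([A_0^l,A_1^l,\dots,A_m^l])\le\ell$ (column-wise concatenation). Extension. A problem (SDPex): $\min\{\langle\widehat{A}_0,\widehat{X}\rangle:\ \widehat{b}_i^l\le\langle\widehat{A}_i,\widehat{X}\rangle\le\widehat{b}_i^u\ \forall i\in[\hat m],\ \widehat{X}\in\mathbb{S}^{\hat n}_+\}$, with $\widehat{A}_i\in\mathbb{S}^{\hat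 n}$ and $-\infty\le\widehat b_i^l\le\widehat b_i^u<+\infty$, is an extension of (SDP) if there is an index set $\mathcal{I}\subset[\hat n]$ such that: for any feasible $\widehat{X}$ of (SDPex), $\widehat{X}_{\mathcal{I},\mathcal{I}}$ is feasible for (SDP) and $\langle\widehat{A}_0,\widehat{X}\rangle=\langle A_0,\widehat{X}_{\mathcal{I},\mathcal{I}}\rangle$; and for any feasible $X$ of (SDP) there is a feasible $\widehat{X}$ of (SDPex) with $\widehat{X}_{\mathcal{I},\mathcal{I}}=X$. Tree decompositions. A tree decomposition of $G=([n],\mathcal{E})$ is a pair $(T,\mathcal{V}=\{V_t\}_{t\in T})$ with $T$ a tree and $V_t\subset[n]$ such that (i) $[n]=\bigcup_t V_t$; (ii) every edge $ij\in\mathcal{E}$ has $i,j\in V_t$ for some $t$; (iii) if $t_2$ lies on the path of $T$ from $t_1$ to $t_3$ then $V_{t_1}\cap V_{t_3}\subset V_{t_2}$. Its width is $\mathrm{wid}(T,\mathcal V)=\max_t|V_t|-1$; $\mathrm{tw}(G)$ is the minimum width over all tree decompositions, $\mathrm{pw}(G)$ the minimum width over those with $T$ a path. $|T|$ is the number of vertices of $T$. A tree decomposition is binary if $T$ has maximum degree at most $3$. Splitting. Given a tree decomposition and a vertex $x\in T$ of degree $k\ge4$ with neighbours $y_1,\dots,y_k$, splitting $x$ means replacing $x$ by a path $x_1x_2\cdots x_k$, replacing each edge $xy_i$ by $x_iy_i$, and assigning $V_x$ to every $x_i$; all other vertex sets are unchanged. Form (E). Let $(T',\mathcal{V}'=\{V_t\}_{t\in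 T'})$ be a binary tree decomposition obtained from $(T,\mathcal{V})$ by repeatedly splitting vertices of degree $>3$ until none remain (so $T'=T$ if $T$ is a path). Identify the vertex set of $T'$ with $[k]$, and root $T'$ at a vertex of degree less than $3$ (an endpoint if $T'$ is a path), labelled $k$. Let $\mathrm{chd}(t)$ and $\mathrm{par}(t)$ denote the sets of children and of parents of $t$. For $t\in[k]$ put $W_t=V_t\setminus\bigcup_{i\in\mathrm{par}(t)}V_i$, $U_t=\{n+(t-1)\ell+1,\dots,n+t\ell\}$, and $\widetilde V_t=V_t\sqcup U_t\sqcup\bigsqcup_{i\in\mathrm{chd}(t)}U_i$. Let $\mathbf{A}=[\mathbf a^1,\dots,\mathbf a^\ell]\in\mathbb{R}^{n\times\ell}$ have columns spanning the range of $[A_0^l,\dots,A_m^l]$, and let $S_i\in\mathbb{S}^\ell$ satisfy $A_i^l=\mathbf{A}S_i\mathbf{A}^\top$ for $i\in\{0,\dots,m\}$. For $h\in[\ell]$, $t\in[k]$ define $\tilde{\mathbf a}^{h,t}\in\mathbb{R}^{\widetilde V_t}$ by $\tilde{\mathbf a}^{h,t}_i=\mathbf a^h_i$ if $i\in W_t$; $=1$ if $i=n+(j-1)\ell+h$ for some $j\in\mathrm{chd}(t)$; $=-1$ if $i=n+(t-1)\ell+h$; and $=0$ otherwise. With $\mathcal{I}=[n]$ and $\mathcal{J}=\{n+(k-1)\ell+1,\dots,n+k\ell\}$, form (E) is the problem $$\min\Big\{\langle A_0^s,\widetilde X_{\mathcal I,\mathcal I}\rangle+\langle S_0,\widetilde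 X_{\mathcal J,\mathcal J}\rangle:\ b_i^l\le\langle A_i^s,\widetilde X_{\mathcal I,\mathcal I}\rangle+\langle S_i,\widetilde X_{\mathcal J,\mathcal J}\rangle\le b_i^u\ \forall i\in[m],\ (\tilde{\mathbf a}^{h,t})^\top\widetilde X_{\widetilde V_t,\widetilde V_t}\tilde{\mathbf a}^{h,t}=0\ \forall h\in[\ell],t\in[k],\ \widetilde X\in\mathbb{S}^{n+k\ell}_+\Big\},$$ so that $\widehat n=n+k\ell$. *)

theory Defs
  imports
    "Jordan_Normal_Form.DL_Rank"
    "Jordan_Normal_Form.DL_Submatrix"
    "HOL-Library.Extended_Real"
begin

text \<open>
  Matrices are those of Jordan_Normal_Form, whose rows and columns are numbered from 0.
  Accordingly the index sets \<open>[n]\<close>, \<open>[\<ell>]\<close> and \<open>[k]\<close> are rendered as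
  \<open>{0..<n}\<close>, \<open>{0..<l}\<close> and \<open>{0..<k}\<close>. Only the numbering of the data
  matrices is kept as it is: 0 is the objective and \<open>1, \<dots>, m\<close> are the constraints.
\<close>

section \<open>Graphs and trees\<close>

text \<open>
  The tree predicate of Graph_Theory is about digraphs, and a symmetric digraph with at least one
  edge contains a directed 2-cycle; hence a type of undirected graphs.
\<close>

record 'a ugraph =
  verts :: "'a set"
  edges :: "'a set set"

definition simple_graph :: "'a ugraph \<Rightarrow> bool" where
  "simple_graph G \<longleftrightarrow>
     finite (verts G) \<and> (\<forall>e\<in>edges G. \<exists>u\<in>verts G. \<exists>v\<in>verts G. u \<noteq> v \<and> e = {u, v})"

definition nbrs :: "'a ugraph \<Rightarrow> 'a \<Rightarrow> 'a set" where
  "nbrs G x = {y. {x, y} \<in> edges G}"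

definition vertex_degree :: "'a ugraph \<Rightarrow> 'a \<Rightarrow> nat" where
  "vertex_degree G x = card (nbrs G x)"

definition is_path :: "'a ugraph \<Rightarrow> 'a list \<Rightarrow> bool" where
  "is_path G xs \<longleftrightarrow>
     xs \<noteq> [] \<and> distinct xs \<and> set xs \<subseteq> verts G \<and>
     (\<forall>i. Suc i < length xs \<longrightarrow> {xs ! i, xs ! Suc i} \<in> edges G)"

definition path_from_to :: "'a ugraph \<Rightarrow> 'a \<Rightarrow> 'a list \<Rightarrow> 'a \<Rightarrow> bool" where
  "path_from_to G u xs v \<longleftrightarrow> is_path G xs \<and> hd xs = u \<and> last xs = v"

definition is_cycle :: "'a ugraph \<Rightarrow> 'a list \<Rightarrow> bool" where
  "is_cycle G xs \<longleftrightarrow> is_path G xs \<and> 3 \<le> length xs \<and> {last xs, hd xs} \<in> edges G"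

definition is_tree :: "'a ugraph \<Rightarrow> bool" where
  "is_tree T \<longleftrightarrow>
     simple_graph T \<and> verts T \<noteq> {} \<and>
     (\<forall>u\<in>verts T. \<forall>v\<in>verts T. \<exists>xs. path_from_to T u xs v) \<and>
     (\<nexists>xs. is_cycle T xs)"

definition on_path :: "'a ugraph \<Rightarrow> 'a \<Rightarrow> 'a \<Rightarrow> 'a \<Rightarrow> bool" where
  "on_path T u w v \<longleftrightarrow> (\<exists>xs. path_from_to T u xs v \<and> w \<in> set xs)"

definition path_graph :: "'a ugraph \<Rightarrow> bool" where
  "path_graph T \<longleftrightarrow>
     (\<exists>xs. xs \<noteq> [] \<and> distinct xs \<and> verts T = set xs \<and>
           edges T = {{xs ! i, xs ! Suc i} | i. Suc i < length xs})"

definition par :: "'a ugraph \<Rightarrow> 'a \<Rightarrow> 'a \<Rightarrow> 'a set" where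
  "par T r t = {s \<in> nbrs T t. on_path T t s r}"

definition chd :: "'a ugraph \<Rightarrow> 'a \<Rightarrow> 'a \<Rightarrow> 'a set" where
  "chd T r t = {s \<in> verts T. t \<in> par T r s}"


section \<open>Tree decompositions\<close>

definition tree_decomposition :: "'a ugraph \<Rightarrow> 't ugraph \<Rightarrow> ('t \<Rightarrow> 'a set) \<Rightarrow> bool" where
  "tree_decomposition G T V \<longleftrightarrow>
     is_tree T \<and>
     verts G = (\<Union>t\<in>verts T. V t) \<and>
     (\<forall>e\<in>edges G. \<exists>t\<in>verts T. e \<subseteq> V t) \<and>
     (\<forall>t1\<in>verts T. \<forall>t2\<in>verts T. \<forall>t3\<in>verts T. on_path T t1 t2 t3 \<longrightarrow> V t1 \<inter> V t3 \<subseteq> V t2)"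

text \<open>Widths are integers: the graph without vertices has treewidth \<open>-1\<close>.\<close>

definition td_width :: "'t ugraph \<Rightarrow> ('t \<Rightarrow> 'a set) \<Rightarrow> int" where
  "td_width T V = int (Max ((\<lambda>t. card (V t)) ` verts T)) - 1"

text \<open>Every finite tree is isomorphic to one on natural numbers, so these suffice in the minimum.\<close>

definition treewidth :: "'a ugraph \<Rightarrow> int" where
  "treewidth G =
     (LEAST w. \<exists>(T :: nat ugraph) V. tree_decomposition G T V \<and> w = td_width T V)"

definition pathwidth :: "'a ugraph \<Rightarrow> int" where
  "pathwidth G =
     (LEAST w. \<exists>(T :: nat ugraph) V. path_graph T \<and> tree_decomposition G T V \<and> w = td_width T V)"

definition is_binary :: "'t ugraph \<Rightarrow> bool" where
  "is_binary T \<longleftrightarrow> (\<forall>t\<in>verts T. vertex_degree T t \<le> 3)"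

text \<open>
  Splitting \<open>x\<close> with neighbours \<open>ys\<close> into the path \<open>xs\<close>. The order of the neighbours and the
  names of the new vertices are arbitrary, and \<open>x\<close> itself may be reused as a name.
\<close>

definition split_vertex ::
  "'t ugraph \<times> ('t \<Rightarrow> 'a set) \<Rightarrow> 't ugraph \<times> ('t \<Rightarrow> 'a set) \<Rightarrow> bool" where
  "split_vertex = (\<lambda>(T, V) (T', V').
     \<exists>x ys xs.
       x \<in> verts T \<and> distinct ys \<and> set ys = nbrs T x \<and> 4 \<le> length ys \<and>
       distinct xs \<and> length xs = length ys \<and> set xs \<inter> (verts T - {x}) = {} \<and>
       verts T' = (verts T - {x}) \<union> set xs \<and>
       edges T' = {e \<in> edges T. x \<notin> e}
         \<union> {{xs ! i, ys ! i} | i. i < length ys}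
         \<union> {{xs ! i, xs ! Suc i} | i. Suc i < length xs} \<and>
       (\<forall>t \<in> verts T - {x}. V' t = V t) \<and>
       (\<forall>t \<in> set xs. V' t = V x))"

definition relabelling ::
  "'s ugraph \<times> ('s \<Rightarrow> 'a set) \<Rightarrow> 't ugraph \<times> ('t \<Rightarrow> 'a set) \<Rightarrow> bool" where
  "relabelling = (\<lambda>(T, V) (T', V').
     \<exists>f. bij_betw f (verts T) (verts T') \<and> edges T' = (\<lambda>e. f ` e) ` edges T \<and>
         (\<forall>t\<in>verts T. V' (f t) = V t))"

text \<open>
  \<open>(T', V')\<close> is a binary tree decomposition with node set \<open>{0..<k}\<close> obtained from \<open>(T, V)\<close>
  by splitting vertices of degree greater than 3 until none remain. The first relabelling serves
  to provide fresh vertex names, which the node type of \<open>T\<close> need not have.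
\<close>

definition binary_splitting ::
  "'t ugraph \<Rightarrow> ('t \<Rightarrow> 'a set) \<Rightarrow> nat \<Rightarrow> nat ugraph \<Rightarrow> (nat \<Rightarrow> 'a set) \<Rightarrow> bool" where
  "binary_splitting T V k T' V' \<longleftrightarrow>
     (\<exists>D0 D1 :: nat ugraph \<times> (nat \<Rightarrow> 'a set).
        relabelling (T, V) D0 \<and> split_vertex\<^sup>*\<^sup>* D0 D1 \<and> is_binary (fst D1) \<and>
        relabelling D1 (T', V') \<and> verts T' = {0..<k})"


section \<open>Semidefinite programs\<close>

definition sym_mats :: "nat \<Rightarrow> real mat set" where
  "sym_mats n = {X \<in> carrier_mat n n. X\<^sup>T = X}"

definition psd_mats :: "nat \<Rightarrow> real mat set" where
  "psd_mats n = {X \<in> sym_mats n. \<forall>v\<in>carrier_vec n. 0 \<le> v \<bullet> (X *\<^sub>v v)}"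

definition trace_inner :: "real mat \<Rightarrow> real mat \<Rightarrow> real" where
  "trace_inner A B = (\<Sum>i<dim_col A. (A\<^sup>T * B) $$ (i, i))"

definition sparse_sym_mats :: "nat \<Rightarrow> nat set set \<Rightarrow> real mat set" where
  "sparse_sym_mats n E =
     {X \<in> sym_mats n. \<forall>i<n. \<forall>j<n. i \<noteq> j \<and> {i, j} \<notin> E \<longrightarrow> X $$ (i, j) = 0}"

text \<open>
  The problem of minimizing the trace inner product of \<open>sdp_mat 0\<close> and \<open>X\<close> subject to
  \<open>sdp_lower i \<le> \<langle>sdp_mat i, X\<rangle> \<le> sdp_upper i\<close> for \<open>i \<in> {1..sdp_ncons}\<close> and to
  \<open>X\<close> being positive semidefinite.
\<close>

record sdp =
  sdp_dim :: nat
  sdp_ncons :: nat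
  sdp_mat :: "nat \<Rightarrow> real mat"
  sdp_lower :: "nat \<Rightarrow> ereal"
  sdp_upper :: "nat \<Rightarrow> ereal"

definition wf_sdp :: "sdp \<Rightarrow> bool" where
  "wf_sdp P \<longleftrightarrow>
     (\<forall>i\<in>{0..sdp_ncons P}. sdp_mat P i \<in> sym_mats (sdp_dim P)) \<and>
     (\<forall>i\<in>{1..sdp_ncons P}. sdp_lower P i \<le> sdp_upper P i \<and> sdp_upper P i < \<infinity>)"

definition sdp_objective :: "sdp \<Rightarrow> real mat \<Rightarrow> real" where
  "sdp_objective P X = trace_inner (sdp_mat P 0) X"

definition sdp_feasible :: "sdp \<Rightarrow> real mat \<Rightarrow> bool" where
  "sdp_feasible P X \<longleftrightarrow>
     X \<in> psd_mats (sdp_dim P) \<and>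
     (\<forall>i\<in>{1..sdp_ncons P}.
        sdp_lower P i \<le> ereal (trace_inner (sdp_mat P i) X) \<and>
        ereal (trace_inner (sdp_mat P i) X) \<le> sdp_upper P i)"

definition sparsity_pattern :: "nat ugraph \<Rightarrow> sdp \<Rightarrow> bool" where
  "sparsity_pattern G P \<longleftrightarrow>
     simple_graph G \<and> verts G = {0..<sdp_dim P} \<and>
     (\<forall>i\<in>{0..sdp_ncons P}. sdp_mat P i \<in> sparse_sym_mats (sdp_dim P) (edges G))"

definition is_extension :: "sdp \<Rightarrow> sdp \<Rightarrow> bool" where
  "is_extension Q P \<longleftrightarrow>
     wf_sdp Q \<and>
     (\<exists>I \<subseteq> {0..<sdp_dim Q}.
        (\<forall>X. sdp_feasible Q X \<longrightarrow>
           sdp_feasible P (submatrix X I I) \<and>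
           sdp_objective Q X = sdp_objective P (submatrix X I I)) \<and>
        (\<forall>X. sdp_feasible P X \<longrightarrow> (\<exists>Y. sdp_feasible Q Y \<and> submatrix Y I I = X)))"


section \<open>Sparse plus low-rank structure\<close>

text \<open>The column-wise concatenation \<open>[M 0, M 1, \<dots>, M m]\<close>.\<close>

definition concat_cols :: "nat \<Rightarrow> nat \<Rightarrow> (nat \<Rightarrow> real mat) \<Rightarrow> real mat" where
  "concat_cols n m M = mat_of_cols n (concat (map (\<lambda>i. cols (M i)) [0..<Suc m]))"

definition splr_decomposition ::
  "sdp \<Rightarrow> nat ugraph \<Rightarrow> nat \<Rightarrow> (nat \<Rightarrow> real mat) \<Rightarrow> (nat \<Rightarrow> real mat) \<Rightarrow> bool" where
  "splr_decomposition P G l As Al \<longleftrightarrow>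
     (\<forall>i\<in>{0..sdp_ncons P}.
        As i \<in> sparse_sym_mats (sdp_dim P) (edges G) \<and>
        Al i \<in> carrier_mat (sdp_dim P) (sdp_dim P) \<and>
        sdp_mat P i = As i + Al i) \<and>
     vec_space.rank (sdp_dim P) (concat_cols (sdp_dim P) (sdp_ncons P) Al) \<le> l"

definition has_splr :: "sdp \<Rightarrow> nat ugraph \<Rightarrow> nat \<Rightarrow> bool" where
  "has_splr P G l \<longleftrightarrow> (\<exists>As Al. splr_decomposition P G l As Al)"

definition low_rank_factors ::
  "sdp \<Rightarrow> nat \<Rightarrow> (nat \<Rightarrow> real mat) \<Rightarrow> real mat \<Rightarrow> (nat \<Rightarrow> real mat) \<Rightarrow> bool" where
  "low_rank_factors P l Al A S \<longleftrightarrow>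
     A \<in> carrier_mat (sdp_dim P) l \<and>
     vec_space.col_space (sdp_dim P) A =
       vec_space.col_space (sdp_dim P) (concat_cols (sdp_dim P) (sdp_ncons P) Al) \<and>
     (\<forall>i\<in>{0..sdp_ncons P}. S i \<in> sym_mats l \<and> Al i = A * S i * A\<^sup>T)"


section \<open>The extended problem\<close>

text \<open>Throughout, \<open>T\<close> is a tree with node set \<open>{0..<k}\<close> and bags \<open>V\<close>, rooted at \<open>r\<close>.\<close>

definition U_set :: "nat \<Rightarrow> nat \<Rightarrow> nat \<Rightarrow> nat set" where
  "U_set n l t = {n + t * l ..< n + (t + 1) * l}"

definition W_set :: "nat ugraph \<Rightarrow> (nat \<Rightarrow> nat set) \<Rightarrow> nat \<Rightarrow> nat \<Rightarrow> nat set" where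
  "W_set T V r t = V t - (\<Union>i\<in>par T r t. V i)"

definition V_ext ::
  "nat \<Rightarrow> nat \<Rightarrow> nat ugraph \<Rightarrow> (nat \<Rightarrow> nat set) \<Rightarrow> nat \<Rightarrow> nat \<Rightarrow> nat set" where
  "V_ext n l T V r t = V t \<union> U_set n l t \<union> (\<Union>i\<in>chd T r t. U_set n l i)"

definition a_ext ::
  "nat \<Rightarrow> nat \<Rightarrow> nat ugraph \<Rightarrow> (nat \<Rightarrow> nat set) \<Rightarrow> nat \<Rightarrow> real mat \<Rightarrow> nat \<Rightarrow> nat \<Rightarrow> nat \<Rightarrow> real" where
  "a_ext n l T V r A h t i =
     (if i \<in> W_set T V r t then A $$ (i, h)
      else if \<exists>j\<in>chd T r t. i = n + j * l + h then 1
      else if i = n + t * l + h then -1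
      else 0)"

text \<open>
  With \<open>I = {0..<n}\<close>, \<open>J = U_set n l r\<close> and \<open>a\<close>, \<open>V\<close> short for \<open>a_ext\<close>, \<open>V_ext\<close>, \<open>Q\<close> is the problem
  \<open>min \<langle>As 0, X\<^sub>I\<^sub>I\<rangle> + \<langle>S 0, X\<^sub>J\<^sub>J\<rangle>\<close> subject to the bounds of \<open>P\<close> on
  \<open>\<langle>As i, X\<^sub>I\<^sub>I\<rangle> + \<langle>S i, X\<^sub>J\<^sub>J\<rangle>\<close> for \<open>i \<in> {1..m}\<close>, and to
  \<open>(a h t)\<^sup>T X\<^sub>V\<^sub>V (a h t) = 0\<close> for \<open>h < l\<close>, \<open>t < k\<close>, where \<open>V\<close> depends on \<open>t\<close>.
  A symmetric coefficient matrix is determined by its inner products with all symmetric matrices,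
  so these linear functionals are stated directly. The constraint for the pair \<open>(h, t)\<close> has number \<open>m + t * l + h + 1\<close>.
\<close>

definition is_form_E ::
  "sdp \<Rightarrow> nat \<Rightarrow> (nat \<Rightarrow> real mat) \<Rightarrow> real mat \<Rightarrow> (nat \<Rightarrow> real mat) \<Rightarrow>
   nat \<Rightarrow> nat ugraph \<Rightarrow> (nat \<Rightarrow> nat set) \<Rightarrow> nat \<Rightarrow> sdp \<Rightarrow> bool" where
  "is_form_E P l As A S k T V r Q \<longleftrightarrow>
     (let n = sdp_dim P; m = sdp_ncons P; N = n + k * l; I = {0..<n}; J = U_set n l r in
        sdp_dim Q = N \<and> sdp_ncons Q = m + k * l \<and>
        (\<forall>i\<in>{0..sdp_ncons Q}. sdp_mat Q i \<in> sym_mats N) \<and>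
        (\<forall>i\<in>{0..m}. \<forall>X\<in>sym_mats N.
           trace_inner (sdp_mat Q i) X =
             trace_inner (As i) (submatrix X I I) + trace_inner (S i) (submatrix X J J)) \<and>
        (\<forall>i\<in>{1..m}. sdp_lower Q i = sdp_lower P i \<and> sdp_upper Q i = sdp_upper P i) \<and>
        (\<forall>h<l. \<forall>t<k.
           let c = m + t * l + h + 1 in
             sdp_lower Q c = 0 \<and> sdp_upper Q c = 0 \<and>
             (\<forall>X\<in>sym_mats N.
                trace_inner (sdp_mat Q c) X =
                  (\<Sum>i\<in>V_ext n l T V r t. \<Sum>j\<in>V_ext n l T V r t.
                     a_ext n l T V r A h t i * X $$ (i, j) * a_ext n l T V r A h t j))))"

text \<open>
  The root is the last of the nodes \<open>{0..<k}\<close>, has degree less than 3 and, in a path, is an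
  endpoint; the single vertex of a one-vertex path counts as an endpoint.
\<close>

definition admissible_root :: "nat ugraph \<Rightarrow> nat \<Rightarrow> nat \<Rightarrow> bool" where
  "admissible_root T k r \<longleftrightarrow>
     0 < k \<and> r = k - 1 \<and> vertex_degree T r < 3 \<and> (path_graph T \<longrightarrow> vertex_degree T r \<le> 1)"

end

theory Submission
  imports Defs "Jordan_Normal_Form.Gram_Schmidt"
begin

text \<open>
  A positive semidefinite \<open>X\<close> with \<open>a\<^sup>T X a = 0\<close> satisfies \<open>X a = 0\<close>. Summing the vectors of the chain
  constraints for fixed \<open>h\<close> over the nodes of the rooted tree gives column \<open>h\<close> of \<open>A\<close> minus the \<open>h\<close>-th unit
  vector of the root's block: the sets \<open>W\<^sub>t\<close> partition \<open>[n]\<close>, and the blocks of the other nodes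
  cancel between a node and its parent. Hence \<open>X\<^sub>J\<^sub>J = A\<^sup>T X\<^sub>I\<^sub>I A\<close>, and \<open>\<langle>S\<^sub>i, X\<^sub>J\<^sub>J\<rangle> = \<langle>A S\<^sub>i A\<^sup>T, X\<^sub>I\<^sub>I\<rangle>\<close>.
  Conversely a feasible \<open>X\<close> lifts to \<open>M X M\<^sup>T\<close>, where the row \<open>(t, h)\<close> of \<open>M\<close> collects the part of
  column \<open>h\<close> of \<open>A\<close> that is introduced at \<open>t\<close> and its descendants.

  The enlarged bags form a tree decomposition of the graph whose edges join the indices that share an
  enlarged bag, and such a bag gains one block for its node and one for each child. The binary tree is
  rooted at a leaf, so that there are at most two children, and at most one in a path. Splitting a node
  of degree \<open>d > 3\<close> replaces it by \<open>d\<close> nodes of degree at most 3; as the degree of a node is at most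
  one more than its number of children, there are at most \<open>2p\<close> nodes in the end.
\<close>

section \<open>Rooted trees\<close>

text \<open>One block holding \<open>A\<^sup>T * X * A\<close> would carry the low-rank terms, but
  tying it to all of \<open>{0..<n}\<close> at once takes constraints with dense coefficients. So
  the sums over \<open>{0..<n}\<close> are accumulated along the tree: the constraints of a node
  meet only its bag, its own partial sums and those of its children, while the low-rank terms meet
  only the totals in the root block.

  Tree decompositions have to be verified for relabelled trees, split trees and enlarged bags, and
  paths are awkward for that. A tree is therefore given by a parent map along which a depth
  decreases. The path condition then becomes local: among the nodes whose bags contain an index,
  only one is topmost. That node is also the only \<open>t\<close> with the index in
  \<open>W_set\<close>, so the same fact yields the partition.

  The matrix \<open>A\<close> must have exactly \<open>l\<close> columns, so they are dependent when
  the rank is smaller, and the \<open>S i\<close> cannot be read off as coordinates in a basis. A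
  matrix \<open>L\<close> with \<open>A * L * A = A\<close> takes the place of an inverse change of
  basis.\<close>

lemma is_path_Cons:
  "is_path G (x # xs) \<longleftrightarrow>
     x \<in> verts G \<and> (xs = [] \<or> is_path G xs \<and> x \<notin> set xs \<and> {x, hd xs} \<in> edges G)"
proof (cases xs)
  case (Cons y ys)
  have "(\<forall>i. Suc i < length (x # xs) \<longrightarrow> {(x # xs) ! i, (x # xs) ! Suc i} \<in> edges G) \<longleftrightarrow>
    {x, hd xs} \<in> edges G \<and> (\<forall>i. Suc i < length xs \<longrightarrow> {xs ! i, xs ! Suc i} \<in> edges G)"
    (is "?L \<longleftrightarrow> ?R")
  proof
    assume L: ?L
    from L[rule_format, of 0] L[rule_format, of "Suc i" for i] show ?R
      using Cons by auto
  next
    assume R: ?R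
    show ?L
    proof (intro allI impI)
      fix i assume "Suc i < length (x # xs)"
      then show "{(x # xs) ! i, (x # xs) ! Suc i} \<in> edges G"
        using R Cons by (cases i) auto
    qed
  qed
  then show ?thesis using Cons unfolding is_path_def by auto
qed (auto simp: is_path_def)

lemma is_path_append:
  assumes "xs \<noteq> []" "ys \<noteq> []"
  shows "is_path G (xs @ ys) \<longleftrightarrow>
    is_path G xs \<and> is_path G ys \<and> set xs \<inter> set ys = {} \<and> {last xs, hd ys} \<in> edges G"
  using assms(1)
proof (induction xs)
  case (Cons x xs)
  then show ?case
    using assms(2) by (cases "xs = []") (auto simp: is_path_Cons)
qed simp

text \<open>Walks are taken in the reflexive transitive closure of this relation: they can be
  concatenated, which the repetition-free lists of \<open>is_path\<close> in general cannot.\<close>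

definition induced_adj :: "'a ugraph \<Rightarrow> 'a set \<Rightarrow> ('a \<times> 'a) set" where
  "induced_adj G B = {(x, y). x \<in> B \<and> y \<in> B \<and> {x, y} \<in> edges G}"

definition induced_connected :: "'a ugraph \<Rightarrow> 'a set \<Rightarrow> bool" where
  "induced_connected G B \<longleftrightarrow> (\<forall>x\<in>B. \<forall>y\<in>B. (x, y) \<in> (induced_adj G B)\<^sup>*)"

text \<open>The path grows at its front. If the new vertex already lies on it, everything before
  that vertex is dropped, so no vertex repeats.\<close>

lemma walk_imp_path:
  assumes "(u, v) \<in> (induced_adj G B)\<^sup>*" "v \<in> B" "B \<subseteq> verts G"
  shows "\<exists>xs. path_from_to G u xs v \<and> set xs \<subseteq> B"
  using assms(1)
proof (induction rule: converse_rtrancl_induct)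
  case base
  have "path_from_to G v [v] v" using assms by (auto simp: path_from_to_def is_path_Cons)
  then show ?case using assms by force
next
  case (step u w)
  then obtain xs where xs: "path_from_to G w xs v" "set xs \<subseteq> B" by blast
  have uw: "u \<in> B" "{u, w} \<in> edges G" using step by (auto simp: induced_adj_def)
  have ne: "xs \<noteq> []" using xs by (auto simp: path_from_to_def is_path_def)
  show ?case
  proof (cases "u \<in> set xs")
    case True
    then obtain as bs where s: "xs = as @ u # bs" by (meson split_list)
    have "is_path G (u # bs)"
      using xs is_path_append[of as "u # bs" G] s by (cases "as = []") (auto simp: path_from_to_def)
    then have "path_from_to G u (u # bs) v" using xs s by (auto simp: path_from_to_def)
    then show ?thesis using xs s by (intro exI[of _ "u # bs"]) auto
  next
    case False
    have "path_from_to G u (u # xs) v"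
      using False xs uw assms ne by (auto simp: path_from_to_def is_path_Cons)
    then show ?thesis using xs uw by (intro exI[of _ "u # xs"]) auto
  qed
qed

lemma path_imp_walk:
  assumes "is_path G xs" "set xs \<subseteq> B"
  shows "(hd xs, last xs) \<in> (induced_adj G B)\<^sup>*"
  using assms
proof (induction xs)
  case (Cons x xs)
  show ?case
  proof (cases "xs = []")
    case False
    then have "(x, hd xs) \<in> induced_adj G B"
      using Cons.prems by (auto simp: is_path_Cons induced_adj_def)
    moreover have "(hd xs, last xs) \<in> (induced_adj G B)\<^sup>*"
      using Cons False by (auto simp: is_path_Cons)
    ultimately show ?thesis using False by simp
  qed simp
qed (simp add: is_path_def)

text \<open>A path leaving \<open>B\<close> contains a detour through outside vertices, from its
  last vertex \<open>b1\<close> in \<open>B\<close> before \<open>w\<close> to its first vertex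
  \<open>b2\<close> in \<open>B\<close> after \<open>w\<close>. A return path from \<open>b2\<close>
  to \<open>b1\<close> inside \<open>B\<close> closes the detour to a cycle.\<close>

lemma acyclic_path_subset:
  assumes "\<nexists>ys. is_cycle G ys" "path_from_to G u xs v" "u \<in> B" "v \<in> B"
    "B \<subseteq> verts G" "induced_connected G B"
  shows "set xs \<subseteq> B"
proof (rule ccontr)
  assume "\<not> set xs \<subseteq> B"
  then obtain w where w: "w \<in> set xs" "w \<notin> B" by auto
  then obtain as cs where s: "xs = as @ w # cs" by (meson split_list)
  have path: "is_path G xs" and hl: "hd xs = u" "last xs = v"
    using assms by (auto simp: path_from_to_def)
  have "as \<noteq> []" "cs \<noteq> []" using hl s w assms by auto
  then have "hd as \<in> set as" "hd as \<in> B" "last cs \<in> set cs" "last cs \<in> B"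
    using s hl assms by auto
  then obtain a1 b1 a2 c1 b2 c2 where
    a: "as = a1 @ b1 # a2" "b1 \<in> B" "\<forall>z\<in>set a2. z \<notin> B" and
    c: "cs = c1 @ b2 # c2" "b2 \<in> B" "\<forall>z\<in>set c1. z \<notin> B"
    using split_list_last_prop[of as "\<lambda>z. z \<in> B"] split_list_first_prop[of cs "\<lambda>z. z \<in> B"]
    by metis
  define ys where "ys = a2 @ w # c1"
  have ys: "ys \<noteq> []" "\<forall>z\<in>set ys. z \<notin> B" using a c w by (auto simp: ys_def)
  have x: "xs = a1 @ (b1 # ys @ b2 # c2)" using s a c by (auto simp: ys_def)
  have "is_path G (b1 # ys @ b2 # c2)"
    using path is_path_append[of a1 "b1 # ys @ b2 # c2" G] x by (cases "a1 = []") auto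
  then have p: "{b1, hd ys} \<in> edges G" "is_path G ys" "{last ys, b2} \<in> edges G" "b1 \<noteq> b2"
    using ys(1) is_path_append[of ys "b2 # c2" G] by (auto simp: is_path_Cons)
  have "(b2, b1) \<in> (induced_adj G B)\<^sup>*" using assms a c by (auto simp: induced_connected_def)
  then obtain zs where z: "path_from_to G b2 zs b1" "set zs \<subseteq> B"
    using walk_imp_path assms a by metis
  then have z': "zs \<noteq> []" "is_path G zs" "hd zs = b2" "last zs = b1"
    by (auto simp: path_from_to_def is_path_def)
  \<comment> \<open>Distinct ends give the return path at least two vertices; the nonempty detour
    adds the third one that \<open>is_cycle\<close> asks for.\<close>
  then have "length zs \<noteq> 1" using \<open>b1 \<noteq> b2\<close> by (auto simp: length_Suc_conv)
  then have "2 \<le> length zs" using z'(1) by (cases zs; cases "tl zs") auto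
  then have "3 \<le> length (ys @ zs)" using ys(1) by (cases ys) auto
  moreover have "is_path G (ys @ zs)"
    using is_path_append[of ys zs G] ys z z' p by auto
  ultimately have "is_cycle G (ys @ zs)"
    using ys z' p by (auto simp: is_cycle_def)
  then show False using assms by blast
qed

lemma is_tree_path:
  assumes "is_tree T" "u \<in> verts T" "v \<in> verts T"
  obtains xs where "path_from_to T u xs v"
  using assms by (force simp: is_tree_def)

text \<open>\<open>depth\<close> need not be the distance from the root. Strict decrease along
  \<open>up\<close> is all that the arguments use, and it is easy to arrange when a leaf is attached
  or a node is replaced by a path. Nothing is required of \<open>up r\<close>.\<close>

locale rooted_tree =
  fixes T :: "'a ugraph" and r :: 'a and up :: "'a \<Rightarrow> 'a" and depth :: "'a \<Rightarrow> nat"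
  assumes finite_verts: "finite (verts T)"
    and root_in: "r \<in> verts T"
    and up_in: "\<And>v. v \<in> verts T \<Longrightarrow> v \<noteq> r \<Longrightarrow> up v \<in> verts T"
    and depth_up: "\<And>v. v \<in> verts T \<Longrightarrow> v \<noteq> r \<Longrightarrow> depth (up v) < depth v"
    and edges_eq: "edges T = {{v, up v} | v. v \<in> verts T \<and> v \<noteq> r}"
begin

lemma edge_cases:
  assumes "{x, y} \<in> edges T"
  obtains "x \<in> verts T" "x \<noteq> r" "y = up x" "y \<in> verts T"
    | "y \<in> verts T" "y \<noteq> r" "x = up y" "x \<in> verts T"
  using assms up_in unfolding edges_eq by (auto simp: doubleton_eq_iff)

lemma up_neq: "v \<in> verts T \<Longrightarrow> v \<noteq> r \<Longrightarrow> up v \<noteq> v"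
  using depth_up by fastforce

lemma simple: "simple_graph T"
  unfolding simple_graph_def edges_eq using finite_verts up_in up_neq by blast

definition topmost :: "'a set \<Rightarrow> 'a \<Rightarrow> bool" where
  "topmost B t \<longleftrightarrow> t \<in> B \<and> (t = r \<or> up t \<notin> B)"

definition anc :: "('a \<times> 'a) set" where
  "anc = {(v, up v) | v. v \<in> verts T \<and> v \<noteq> r}"

lemma anc_depth: "(s, t) \<in> anc\<^sup>* \<Longrightarrow> s = t \<or> depth t < depth s"
  by (induction rule: rtrancl_induct) (auto simp: anc_def dest: depth_up)

lemma ex_topmost:
  assumes "B \<subseteq> verts T" "s \<in> B"
  shows "\<exists>t. topmost B t \<and> (s, t) \<in> anc\<^sup>* \<and> (s, t) \<in> (induced_adj T B)\<^sup>* \<and> (t, s) \<in> (induced_adj T B)\<^sup>*"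
  using assms(2)
proof (induction "depth s" arbitrary: s rule: less_induct)
  case less
  show ?case
  proof (cases "topmost B s")
    case False
    then have u: "s \<noteq> r" "up s \<in> B" "s \<in> verts T" using less assms by (auto simp: topmost_def)
    then have e: "{s, up s} \<in> edges T" by (auto simp: edges_eq)
    then have "(s, up s) \<in> anc" "(s, up s) \<in> induced_adj T B" "(up s, s) \<in> induced_adj T B"
      using u less by (auto simp: anc_def induced_adj_def insert_commute)
    then show ?thesis using less(1)[of "up s"] u depth_up[of s]
      by (meson converse_rtrancl_into_rtrancl rtrancl.rtrancl_into_rtrancl)
  qed blast
qed

text \<open>A walk inside \<open>B\<close> that starts at a topmost node stays among its
  descendants, since climbing above the start would leave \<open>B\<close>. Two topmost nodes of a
  connected set are thus ancestors of each other, and depth makes them equal. Conversely, every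
  element of \<open>B\<close> climbs inside \<open>B\<close> to a topmost node.\<close>

lemma induced_connected_iff:
  assumes "B \<subseteq> verts T"
  shows "induced_connected T B \<longleftrightarrow> (\<forall>s t. topmost B s \<longrightarrow> topmost B t \<longrightarrow> s = t)"
proof
  assume conn: "induced_connected T B"
  have desc: "(y, s) \<in> anc\<^sup>*" if "topmost B s" "(s, y) \<in> (induced_adj T B)\<^sup>*" for s y
    using that(2)
  proof (induction rule: rtrancl_induct)
    case (step y z)
    then have yz: "y \<in> B" "z \<in> B" "{y, z} \<in> edges T" by (auto simp: induced_adj_def)
    from yz(3) show ?case
    proof (cases rule: edge_cases)
      case 1
      then have "y \<noteq> s" using that(1) yz by (auto simp: topmost_def)
      then obtain w where "(y, w) \<in> anc" "(w, s) \<in> anc\<^sup>*"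
        using step.IH by (meson converse_rtranclE)
      then show ?thesis using 1 by (auto simp: anc_def)
    next
      case 2
      then have "(z, y) \<in> anc" by (auto simp: anc_def)
      then show ?thesis using step.IH by simp
    qed
  qed simp
  show "\<forall>s t. topmost B s \<longrightarrow> topmost B t \<longrightarrow> s = t"
  proof (intro allI impI)
    fix s t assume st: "topmost B s" "topmost B t"
    then have "(s, t) \<in> anc\<^sup>*" "(t, s) \<in> anc\<^sup>*"
      using conn desc by (auto simp: induced_connected_def topmost_def)
    then show "s = t" using anc_depth[of s t] anc_depth[of t s] order.asym by blast
  qed
next
  assume uniq: "\<forall>s t. topmost B s \<longrightarrow> topmost B t \<longrightarrow> s = t"
  show "induced_connected T B" unfolding induced_connected_def
  proof (intro ballI)
    fix x y assume "x \<in> B" "y \<in> B"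
    then show "(x, y) \<in> (induced_adj T B)\<^sup>*"
      using ex_topmost[OF assms, of x] ex_topmost[OF assms, of y] uniq rtrancl_trans by fast
  qed
qed

lemma connected: "induced_connected T (verts T)"
  unfolding induced_connected_iff[OF order_refl] using up_in by (auto simp: topmost_def)

text \<open>Both neighbours on the cycle of a vertex of greatest depth must be its parent, so they
  coincide, while a cycle has at least three distinct vertices.\<close>

lemma acyclic: "\<nexists>xs. is_cycle T xs"
proof
  assume "\<exists>xs. is_cycle T xs"
  then obtain xs where c: "is_cycle T xs" ..
  define N where "N = length xs"
  have N: "3 \<le> N" "distinct xs" "set xs \<subseteq> verts T" "xs \<noteq> []"
    using c by (auto simp: is_cycle_def is_path_def N_def)
  have e: "{xs ! i, xs ! (Suc i mod N)} \<in> edges T" if "i < N" for i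
  proof (cases "Suc i < N")
    case False
    then have "i = N - 1" using that by simp
    then show ?thesis using c N by (auto simp: is_cycle_def last_conv_nth hd_conv_nth N_def)
  qed (use c in \<open>auto simp: is_cycle_def is_path_def N_def\<close>)
  have "Max (depth ` set xs) \<in> depth ` set xs" using N by (intro Max_in) auto
  then obtain x where x: "x \<in> set xs" "depth x = Max (depth ` set xs)" by auto
  then have mx: "depth y \<le> depth x" if "y \<in> set xs" for y using that by auto
  have nb: "y = up x" if "{x, y} \<in> edges T" "y \<in> set xs" for y
    using that(1)
  proof (cases rule: edge_cases)
    case 2
    then show ?thesis using mx[OF that(2)] depth_up[of y] by simp
  qed
  obtain i where i: "i < N" "x = xs ! i" using x by (auto simp: in_set_conv_nth N_def)
  \<comment> \<open>The predecessor of \<open>i\<close> in cyclic order; like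
    \<open>Suc i mod N\<close> it wraps around through the closing edge of the cycle.\<close>
  define j where "j = (if i = 0 then N - 1 else i - 1)"
  have j: "j < N" "Suc j mod N = i" using i N by (auto simp: j_def)
  have "xs ! (Suc i mod N) = up x" "xs ! j = up x"
    using nb e[OF i(1)] e[OF j(1)] i j N by (auto simp: N_def insert_commute)
  then have "Suc i mod N = j"
    using N j i by (metis N_def mod_less_divisor nth_eq_iff_index_eq less_zeroE not_gr_zero)
  then show False using i j N
    by (cases "i = 0"; cases "Suc i = N") (auto simp: j_def)
qed

lemma is_tree: "is_tree T"
  unfolding is_tree_def
proof (intro conjI ballI)
  fix u v assume "u \<in> verts T" "v \<in> verts T"
  then show "\<exists>xs. path_from_to T u xs v"
    using walk_imp_path[of u v T "verts T"] connected by (auto simp: induced_connected_def)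
qed (use simple root_in acyclic in auto)

lemma nbrs_eq:
  assumes "t \<in> verts T"
  shows "nbrs T t = (if t = r then {} else {up t}) \<union> {s \<in> verts T. s \<noteq> r \<and> up s = t}"
  using assms by (auto simp: nbrs_def edges_eq doubleton_eq_iff)

text \<open>The depth bound keeps \<open>t\<close> off the path that the induction provides for
  \<open>up t\<close>.\<close>

lemma path_up: "\<exists>xs. path_from_to T t xs r \<and> (t \<noteq> r \<longrightarrow> up t \<in> set xs) \<and> (\<forall>x\<in>set xs. depth x \<le> depth t)"
  if "t \<in> verts T" for t
  using that
proof (induction "depth t" arbitrary: t rule: less_induct)
  case less
  show ?case
  proof (cases "t = r")
    case True
    then show ?thesis using root_in
      by (intro exI[of _ "[r]"]) (auto simp: path_from_to_def is_path_Cons)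
  next
    case False
    have d: "depth (up t) < depth t" using depth_up False less by auto
    obtain xs where xs: "path_from_to T (up t) xs r" "\<forall>x\<in>set xs. depth x \<le> depth (up t)"
      using less(1)[OF d] up_in less False by blast
    have "{t, up t} \<in> edges T" using less False by (auto simp: edges_eq)
    moreover have "xs \<noteq> []" using xs by (auto simp: path_from_to_def is_path_def)
    moreover have "t \<notin> set xs" using xs d by force
    ultimately have "path_from_to T t (t # xs) r"
      using xs less by (auto simp: path_from_to_def is_path_Cons)
    moreover have "up t \<in> set xs"
      using xs(1) hd_in_set[OF \<open>xs \<noteq> []\<close>] unfolding path_from_to_def by metis
    moreover have "\<forall>x\<in>set (t#xs). depth x \<le> depth t" using xs d by force
    ultimately show ?thesis by (metis list.set_intros(2))
  qed
qed

text \<open>A path from \<open>t\<close> to the root cannot pass through a child \<open>s\<close> of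
  \<open>t\<close>: the nodes that are not at or below \<open>s\<close> form a set with
  \<open>r\<close> as its only topmost node, hence a connected one, and it contains both
  \<open>t\<close> and \<open>r\<close>.\<close>

lemma par_eq:
  assumes "t \<in> verts T"
  shows "par T r t = (if t = r then {} else {up t})"
proof -
  have "up t \<in> par T r t" if "t \<noteq> r"
    using path_up[OF assms] that assms by (auto simp: par_def nbrs_eq on_path_def)
  moreover have "s \<notin> par T r t" if s: "s \<in> verts T" "s \<noteq> r" "up s = t" for s
  proof
    assume "s \<in> par T r t"
    then obtain xs where xs: "path_from_to T t xs r" "s \<in> set xs"
      by (auto simp: par_def on_path_def)
    define B where "B = {y \<in> verts T. (y, s) \<notin> anc\<^sup>*}"
    have "topmost B y \<Longrightarrow> y = r" for y
      using up_in by (auto simp: topmost_def B_def anc_def intro: converse_rtrancl_into_rtrancl)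
    then have "induced_connected T B"
      by (subst induced_connected_iff) (auto simp: B_def)
    moreover have "r \<in> B" using s root_in
      by (auto simp: B_def anc_def elim: converse_rtranclE)
    moreover have "t \<in> B" using s anc_depth[of t s] depth_up[of s] up_in[of s]
      by (auto simp: B_def)
    ultimately have "set xs \<subseteq> B" using acyclic_path_subset[OF acyclic xs(1)] by (auto simp: B_def)
    then show False using xs by (auto simp: B_def)
  qed
  moreover have "par T r t \<subseteq> nbrs T t" by (auto simp: par_def)
  ultimately show ?thesis using assms by (auto simp: nbrs_eq split: if_splits)
qed

lemma chd_eq: "chd T r t = {s \<in> verts T. s \<noteq> r \<and> up s = t}"
  using par_eq by (auto simp: chd_def split: if_splits)

text \<open>
  The third condition says that the bags containing \<open>i\<close> form a subtree, equivalently that only one of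
  them is topmost.
\<close>

lemma tree_decomposition_iff:
  "tree_decomposition G T V \<longleftrightarrow>
     verts G = (\<Union>t\<in>verts T. V t) \<and> (\<forall>e\<in>edges G. \<exists>t\<in>verts T. e \<subseteq> V t) \<and>
     (\<forall>i s t. topmost {t \<in> verts T. i \<in> V t} s \<longrightarrow> topmost {t \<in> verts T. i \<in> V t} t \<longrightarrow> s = t)"
proof -
  have "(\<forall>t1\<in>verts T. \<forall>t2\<in>verts T. \<forall>t3\<in>verts T. on_path T t1 t2 t3 \<longrightarrow> V t1 \<inter> V t3 \<subseteq> V t2) \<longleftrightarrow>
    (\<forall>i. induced_connected T {t \<in> verts T. i \<in> V t})" (is "?L \<longleftrightarrow> ?R")
  proof
    assume L: ?L
    show ?R
    proof (intro allI, unfold induced_connected_def, intro ballI)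
      fix i x y assume xy: "x \<in> {t \<in> verts T. i \<in> V t}" "y \<in> {t \<in> verts T. i \<in> V t}"
      obtain xs where xs: "path_from_to T x xs y"
        using is_tree_path[OF is_tree] xy by blast
      have sub: "set xs \<subseteq> verts T" using xs by (auto simp: path_from_to_def is_path_def)
      have "set xs \<subseteq> {t \<in> verts T. i \<in> V t}"
      proof
        fix z assume z: "z \<in> set xs"
        then have "on_path T x z y" using xs by (auto simp: on_path_def)
        then show "z \<in> {t \<in> verts T. i \<in> V t}" using L xy z sub by blast
      qed
      then show "(x, y) \<in> (induced_adj T {t \<in> verts T. i \<in> V t})\<^sup>*"
        using path_imp_walk[of T xs "{t \<in> verts T. i \<in> V t}"] xs unfolding path_from_to_def by metis
    qed
  next
    assume R: ?R
    show ?L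
    proof (intro ballI impI subsetI)
      fix t1 t2 t3 i assume a: "t1 \<in> verts T" "t3 \<in> verts T" "on_path T t1 t2 t3" "i \<in> V t1 \<inter> V t3"
      then obtain xs where xs: "path_from_to T t1 xs t3" "t2 \<in> set xs" by (auto simp: on_path_def)
      have "set xs \<subseteq> {t \<in> verts T. i \<in> V t}"
        using acyclic_path_subset[OF acyclic xs(1)] a R by auto
      then show "i \<in> V t2" using xs by auto
    qed
  qed
  moreover have "induced_connected T {t \<in> verts T. i \<in> V t} \<longleftrightarrow>
    (\<forall>s t. topmost {t \<in> verts T. i \<in> V t} s \<longrightarrow> topmost {t \<in> verts T. i \<in> V t} t \<longrightarrow> s = t)" for i
    by (rule induced_connected_iff) auto
  ultimately show ?thesis using is_tree unfolding tree_decomposition_def by presburger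
qed

end

lemma is_path_mono:
  assumes "is_path G xs" "verts G \<subseteq> verts H" "edges G \<subseteq> edges H"
  shows "is_path H xs"
  using assms unfolding is_path_def by (meson subset_iff)

text \<open>
  A maximal rooted subtree exhausts the vertices by connectivity, and an edge outside of it would
  close a cycle.
\<close>

lemma is_tree_imp_rooted:
  assumes "is_tree T" "r \<in> verts T"
  shows "\<exists>up depth. rooted_tree T r up depth"
proof -
  define Q where "Q S f d \<longleftrightarrow> S \<subseteq> verts T \<and>
    rooted_tree \<lparr>verts = S, edges = {{v, f v} | v. v \<in> S \<and> v \<noteq> r}\<rparr> r f d \<and>
    {{v, f v} | v. v \<in> S \<and> v \<noteq> r} \<subseteq> edges T" for S f and d :: "_ \<Rightarrow> nat"
  have fin: "finite (verts T)" using assms by (auto simp: is_tree_def simple_graph_def)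
  have Q0: "Q {r} id (\<lambda>_. 0)" using assms by (auto simp: Q_def rooted_tree_def)
  have "\<exists>S. (\<exists>f d. Q S f d) \<and> (\<forall>S'. (\<exists>f d. Q S' f d) \<longrightarrow> card S' \<le> card S)"
    using ex_has_greatest_nat[of "\<lambda>S. \<exists>f d. Q S f d" "{r}" card "Suc (card (verts T))"] Q0 fin
    by (metis (no_types, lifting) Q_def card_mono less_Suc_eq_le)
  then obtain S f d where Q: "Q S f d" and mx: "\<And>S' f d. Q S' f d \<Longrightarrow> card S' \<le> card S" by blast
  interpret R: rooted_tree "\<lparr>verts = S, edges = {{v, f v} | v. v \<in> S \<and> v \<noteq> r}\<rparr>" r f d
    using Q by (auto simp: Q_def)
  have S: "S \<subseteq> verts T" "r \<in> S" "finite S"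
    using Q R.root_in fin finite_subset by (auto simp: Q_def)
  have "S = verts T"
  proof (rule ccontr)
    assume "S \<noteq> verts T"
    then obtain v where v: "v \<in> verts T" "v \<notin> S" using S by auto
    then obtain xs where "path_from_to T v xs r" using assms is_tree_path by metis
    then have "(v, r) \<in> (induced_adj T (verts T))\<^sup>*"
      using path_imp_walk[of T xs "verts T"] by (auto simp: path_from_to_def is_path_def)
    then have "\<exists>x y. x \<notin> S \<and> y \<in> S \<and> (x, y) \<in> induced_adj T (verts T)"
      using v(2) S(2)
    proof (induction rule: converse_rtrancl_induct)
      case (step x y)
      then show ?case by (cases "y \<in> S") auto
    qed simp
    then obtain x y where xy: "x \<in> verts T" "x \<notin> S" "y \<in> S" "{x, y} \<in> edges T"
      by (auto simp: induced_adj_def)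
    define f' d' where "f' = f(x := y)" and "d' = d(x := Suc (d y))"
    have f: "f v \<in> S" "d (f v) < d v" if "v \<in> S" "v \<noteq> r" for v
      using R.up_in R.depth_up that by auto
    have "rooted_tree \<lparr>verts = insert x S, edges = {{v, f' v} | v. v \<in> insert x S \<and> v \<noteq> r}\<rparr> r f' d'"
    proof
      fix v assume "v \<in> verts \<lparr>verts = insert x S, edges = {{v, f' v} | v. v \<in> insert x S \<and> v \<noteq> r}\<rparr>"
        and "v \<noteq> r"
      then have v: "v \<in> insert x S" "v \<noteq> r" by auto
      show "f' v \<in> verts \<lparr>verts = insert x S, edges = {{v, f' v} | v. v \<in> insert x S \<and> v \<noteq> r}\<rparr>"
        using v f xy by (auto simp: f'_def)
      show "d' (f' v) < d' v" using v f[of v] xy by (auto simp: f'_def d'_def)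
    qed (use S in auto)
    moreover have "{{v, f' v} | v. v \<in> insert x S \<and> v \<noteq> r} \<subseteq> edges T"
      using Q xy by (auto simp: Q_def f'_def insert_commute)
    ultimately have "Q (insert x S) f' d'" using S xy by (auto simp: Q_def)
    from mx[OF this] show False using xy S by simp
  qed
  moreover have "edges T \<subseteq> {{v, f v} | v. v \<in> S \<and> v \<noteq> r}"
  proof
    fix e assume e: "e \<in> edges T"
    have "simple_graph T" using assms by (simp add: is_tree_def)
    then obtain u v where uv: "u \<in> verts T" "v \<in> verts T" "u \<noteq> v" "e = {u, v}"
      using e unfolding simple_graph_def by blast
    show "e \<in> {{v, f v} | v. v \<in> S \<and> v \<noteq> r}"
    proof (rule ccontr)
      let ?R = "\<lparr>verts = S, edges = {{v, f v} | v. v \<in> S \<and> v \<noteq> r}\<rparr>"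
      assume ne: "e \<notin> {{v, f v} | v. v \<in> S \<and> v \<noteq> r}"
      obtain xs where xs: "path_from_to ?R u xs v"
        using is_tree_path[OF R.is_tree, of u v] uv \<open>S = verts T\<close> by auto
      then have p: "is_path ?R xs" "xs \<noteq> []" "hd xs = u" "last xs = v"
        by (auto simp: path_from_to_def is_path_def)
      \<comment> \<open>A path of two vertices would be the edge \<open>e\<close> itself, which by
        assumption is not an edge of the subtree.\<close>
      have "3 \<le> length xs"
      proof (rule ccontr)
        assume "\<not> 3 \<le> length xs"
        moreover have "length xs \<noteq> 0" using p by simp
        ultimately have "length xs = 1 \<or> length xs = 2" by linarith
        then show False
        proof
          assume "length xs = 2"
          then have "xs = [u, v]" using p
            by (auto simp: length_Suc_conv numeral_2_eq_2)
          then show False using p ne uv by (auto simp: is_path_Cons)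
        qed (use p uv in \<open>auto simp: length_Suc_conv\<close>)
      qed
      moreover have "is_path T xs" using p(1) by (rule is_path_mono) (use Q in \<open>auto simp: Q_def\<close>)
      ultimately have "is_cycle T xs" using e uv p by (auto simp: is_cycle_def insert_commute)
      then show False using assms by (auto simp: is_tree_def)
    qed
  qed
  ultimately have "\<lparr>verts = S, edges = {{v, f v} | v. v \<in> S \<and> v \<noteq> r}\<rparr> = T"
    using Q by (auto simp: Q_def)
  then show ?thesis using R.rooted_tree_axioms by metis
qed

lemma tree_decomposition_rooted:
  assumes "tree_decomposition G T V" "r \<in> verts T"
  obtains up depth where "rooted_tree T r up depth"
proof -
  have "is_tree T" using assms(1) by (simp add: tree_decomposition_def)
  then show ?thesis using is_tree_imp_rooted assms(2) that by metis
qed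

lemma tree_decomposition_finite:
  assumes "tree_decomposition G T V"
  shows "finite (verts T)" "verts T \<noteq> {}" "simple_graph T"
proof -
  have "is_tree T" using assms by (simp add: tree_decomposition_def)
  then show "verts T \<noteq> {}" "simple_graph T" by (simp_all add: is_tree_def)
  then show "finite (verts T)" by (simp add: simple_graph_def)
qed

lemma nbrs_subset:
  assumes "simple_graph T"
  shows "nbrs T t \<subseteq> verts T"
proof
  fix y assume "y \<in> nbrs T t"
  then obtain u v where "u \<in> verts T" "v \<in> verts T" "{t, y} = {u, v}"
    using assms unfolding simple_graph_def nbrs_def by blast
  then show "y \<in> verts T" by (auto simp: doubleton_eq_iff)
qed

section \<open>Relabelling of trees and their decompositions\<close>

lemma relabelling_degree:
  assumes "simple_graph T" "inj_on f (verts T)" "t \<in> verts T"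
    and "edges T' = (\<lambda>e. f ` e) ` edges T"
  shows "vertex_degree T' (f t) = vertex_degree T t"
proof -
  have "nbrs T' (f t) = f ` nbrs T t"
  proof
    show "f ` nbrs T t \<subseteq> nbrs T' (f t)"
    proof
      fix y assume "y \<in> f ` nbrs T t"
      then obtain z where "{t, z} \<in> edges T" "y = f z" by (auto simp: nbrs_def)
      then have "f ` {t, z} \<in> edges T'" using assms(4) by blast
      then show "y \<in> nbrs T' (f t)" using \<open>y = f z\<close> by (simp add: nbrs_def)
    qed
    show "nbrs T' (f t) \<subseteq> f ` nbrs T t"
    proof
      fix y assume "y \<in> nbrs T' (f t)"
      then obtain e where e: "e \<in> edges T" "{f t, y} = f ` e" using assms(4) by (auto simp: nbrs_def)
      then obtain u v where uv: "u \<in> verts T" "v \<in> verts T" "e = {u, v}"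
        using assms(1) unfolding simple_graph_def by blast
      then have "f t = f u \<and> y = f v \<or> f t = f v \<and> y = f u"
        using e by (auto simp: doubleton_eq_iff)
      then have "t = u \<and> y = f v \<or> t = v \<and> y = f u"
        using assms(2,3) uv by (auto dest: inj_onD)
      then show "y \<in> f ` nbrs T t" using e uv by (auto simp: nbrs_def insert_commute)
    qed
  qed
  moreover have "inj_on f (nbrs T t)" using assms nbrs_subset inj_on_subset by metis
  ultimately show ?thesis by (simp add: vertex_degree_def card_image)
qed

lemma (in rooted_tree) image_rooted_tree:
  assumes "inj_on f (verts T)" "verts T' = f ` verts T" "edges T' = (\<lambda>e. f ` e) ` edges T"
    and up': "\<And>t. t \<in> verts T \<Longrightarrow> up' (f t) = f (up t)"
    and depth': "\<And>t. t \<in> verts T \<Longrightarrow> depth' (f t) = depth t"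
  shows "rooted_tree T' (f r) up' depth'"
proof
  have inj: "f t = f r \<longleftrightarrow> t = r" if "t \<in> verts T" for t
    using assms(1) root_in that by (auto dest: inj_onD)
  show "finite (verts T')" "f r \<in> verts T'" using finite_verts root_in assms by auto
  show "up' v \<in> verts T'" if "v \<in> verts T'" "v \<noteq> f r" for v
    using that assms(2) up' up_in inj by auto
  show "depth' (up' v) < depth' v" if "v \<in> verts T'" "v \<noteq> f r" for v
    using that assms(2) up' up_in depth' depth_up inj by auto
  have "edges T' = {f ` {v, up v} | v. v \<in> verts T \<and> v \<noteq> r}"
    unfolding assms(3) edges_eq by blast
  also have "\<dots> = {{v, up' v} |v. v \<in> verts T' \<and> v \<noteq> f r}"
  proof (rule Set.set_eqI, rule iffI)
    fix e assume "e \<in> {f ` {v, up v} | v. v \<in> verts T \<and> v \<noteq> r}"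
    then obtain v where "v \<in> verts T" "v \<noteq> r" "e = {f v, up' (f v)}" using up' by auto
    then show "e \<in> {{v, up' v} |v. v \<in> verts T' \<and> v \<noteq> f r}" using inj assms(2) by blast
  next
    fix e assume "e \<in> {{v, up' v} |v. v \<in> verts T' \<and> v \<noteq> f r}"
    then obtain v where v: "v \<in> verts T" "f v \<noteq> f r" "e = {f v, up' (f v)}" using assms(2) by auto
    then have "v \<noteq> r" "e = f ` {v, up v}" using up' by auto
    then show "e \<in> {f ` {v, up v} | v. v \<in> verts T \<and> v \<noteq> r}" using v(1) by blast
  qed
  finally show "edges T' = {{v, up' v} |v. v \<in> verts T' \<and> v \<noteq> f r}" .
qed

lemma relabelling_tree_decomposition:
  assumes td: "tree_decomposition G T V" and f: "bij_betw f (verts T) (verts T')"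
    and e: "edges T' = (\<lambda>e. f ` e) ` edges T" and V': "\<And>t. t \<in> verts T \<Longrightarrow> V' (f t) = V t"
  shows "tree_decomposition G T' V'"
proof -
  obtain r where r: "r \<in> verts T" using tree_decomposition_finite[OF td] by auto
  then obtain up depth where "rooted_tree T r up depth" using tree_decomposition_rooted[OF td] by blast
  then interpret R: rooted_tree T r up depth .
  have inj: "inj_on f (verts T)" and im: "verts T' = f ` verts T" using f by (auto simp: bij_betw_def)
  define g where "g = inv_into (verts T) f"
  have gf: "g (f t) = t" if "t \<in> verts T" for t using inj that by (simp add: g_def)
  interpret R': rooted_tree T' "f r" "f \<circ> up \<circ> g" "depth \<circ> g"
    using R.image_rooted_tree[OF inj im e] gf by simp
  have topmost: "R'.topmost {t \<in> verts T'. i \<in> V' t} (f t) \<longleftrightarrow> R.topmost {t \<in> verts T. i \<in> V t} t"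
    if t: "t \<in> verts T" for t i
  proof (cases "t = r")
    case True
    then show ?thesis using t im V' by (auto simp: R.topmost_def R'.topmost_def)
  next
    case False
    then have "f t \<noteq> f r" using inj t r by (auto dest: inj_onD)
    then show ?thesis using t im V' gf R.up_in[OF t False] False
      by (auto simp: R.topmost_def R'.topmost_def)
  qed
  have td': "verts G = (\<Union>t\<in>verts T. V t)" "\<And>e. e \<in> edges G \<Longrightarrow> \<exists>t\<in>verts T. e \<subseteq> V t"
    "\<And>i s t. R.topmost {t \<in> verts T. i \<in> V t} s \<Longrightarrow> R.topmost {t \<in> verts T. i \<in> V t} t \<Longrightarrow> s = t"
    using td unfolding R.tree_decomposition_iff by blast+
  show ?thesis unfolding R'.tree_decomposition_iff
  proof (intro conjI allI impI ballI)
    show "verts G = (\<Union>t\<in>verts T'. V' t)" using td'(1) im V' by auto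
    show "\<exists>t\<in>verts T'. e \<subseteq> V' t" if "e \<in> edges G" for e using td'(2)[OF that] im V' by auto
    fix i s t
    assume st: "R'.topmost {t \<in> verts T'. i \<in> V' t} s" "R'.topmost {t \<in> verts T'. i \<in> V' t} t"
    then have "s \<in> verts T'" "t \<in> verts T'" by (auto simp: R'.topmost_def)
    then obtain s0 t0 where "s = f s0" "t = f t0" "s0 \<in> verts T" "t0 \<in> verts T" using im by auto
    then show "s = t" using st topmost td'(3) by blast
  qed
qed

section \<open>Splitting into binary trees\<close>

text \<open>The number of nodes that result from splitting all nodes of degree greater than 3.\<close>

definition split_size :: "'a ugraph \<Rightarrow> nat" where
  "split_size T = (\<Sum>t\<in>verts T. if 3 < vertex_degree T t then vertex_degree T t else 1)"

lemma card_le_split_size: "card (verts T) \<le> split_size T"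
proof -
  have "(\<Sum>t\<in>verts T. 1) \<le> split_size T"
    unfolding split_size_def by (rule sum_mono) simp
  then show ?thesis by simp
qed

lemma (in rooted_tree) degree_le:
  assumes "t \<in> verts T"
  shows "vertex_degree T t \<le> Suc (card {s \<in> verts T - {r}. up s = t})"
proof -
  have "nbrs T t \<subseteq> insert (up t) {s \<in> verts T - {r}. up s = t}" using nbrs_eq[OF assms] by auto
  then have "vertex_degree T t \<le> card (insert (up t) {s \<in> verts T - {r}. up s = t})"
    unfolding vertex_degree_def using finite_verts by (intro card_mono) auto
  also have "\<dots> \<le> Suc (card {s \<in> verts T - {r}. up s = t})" by (rule card_insert_le_m1) simp_all
  finally show ?thesis .
qed

text \<open>One for each node plus one for each of its children counts every node once and every
  node but the root a second time.\<close>

lemma (in rooted_tree) split_size_le: "split_size T \<le> 2 * card (verts T)"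
proof -
  have "split_size T \<le> (\<Sum>t\<in>verts T. 1 + card {s \<in> verts T - {r}. up s = t})"
    unfolding split_size_def using degree_le by (intro sum_mono) auto
  also have "\<dots> = card (verts T) + (\<Sum>t\<in>verts T. \<Sum>s\<in>{s \<in> verts T - {r}. up s = t}. 1)"
    unfolding sum.distrib by simp
  also have "(\<Sum>t\<in>verts T. \<Sum>s\<in>{s \<in> verts T - {r}. up s = t}. 1) = (\<Sum>s\<in>verts T - {r}. 1::nat)"
    using finite_verts up_in by (intro sum.group) auto
  also have "\<dots> \<le> card (verts T)" using finite_verts by (simp add: card_mono)
  finally show ?thesis by simp
qed

text \<open>A node of greatest depth has no children, so at most its parent is a neighbour.\<close>

lemma (in rooted_tree) ex_leaf: "\<exists>t\<in>verts T. vertex_degree T t \<le> 1"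
proof -
  have "Max (depth ` verts T) \<in> depth ` verts T" using finite_verts root_in by (intro Max_in) auto
  then obtain t where t: "t \<in> verts T" "depth t = Max (depth ` verts T)" by auto
  then have "depth s \<le> depth t" if "s \<in> verts T" for s using that finite_verts by auto
  then have "{s \<in> verts T - {r}. up s = t} = {}" using depth_up by fastforce
  then have "card {s \<in> verts T - {r}. up s = t} = 0" by (metis card.empty)
  then show ?thesis using degree_le[OF t(1)] t(1) by fastforce
qed

text \<open>Rooted at \<open>x\<close>, all neighbours of \<open>x\<close> are its children. The new
  path descends from its first vertex, the new root, and each of its vertices takes over one child
  of \<open>x\<close>. The number of nodes of degree above 3 is the measure for the iteration;
  \<open>split_size\<close> and the set of bags are what it preserves.\<close>

lemma ex_split_vertex:
  fixes T :: "nat ugraph"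
  assumes td: "tree_decomposition G T V" and x: "x \<in> verts T" and deg: "3 < vertex_degree T x"
  shows "\<exists>T' V'. split_vertex (T, V) (T', V') \<and> tree_decomposition G T' V' \<and>
    split_size T' = split_size T \<and> V' ` verts T' = V ` verts T \<and>
    card {t \<in> verts T'. 3 < vertex_degree T' t} < card {t \<in> verts T. 3 < vertex_degree T t}"
proof -
  obtain up depth where "rooted_tree T x up depth" using tree_decomposition_rooted[OF td x] .
  then interpret R: rooted_tree T x up depth .
  note fin = R.finite_verts
  have nbx: "nbrs T x = {s \<in> verts T. s \<noteq> x \<and> up s = x}" using R.nbrs_eq[OF x] by simp
  then have "finite (nbrs T x)" using fin by simp
  then obtain ys where ys: "distinct ys" "set ys = nbrs T x" using finite_distinct_list by blast
  define q where "q = length ys"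
  have q: "vertex_degree T x = q" "3 < q" "0 < q"
    using deg ys by (auto simp: vertex_degree_def q_def distinct_card[symmetric])
  \<comment> \<open>Names from \<open>M\<close> on are fresh, and \<open>M \<le> v\<close> tells the
    vertices of the path from the old ones.\<close>
  define M where "M = Suc (Max (verts T))"
  have M: "v < M" if "v \<in> verts T" for v using that fin by (simp add: M_def less_Suc_eq_le)
  define xs where "xs = [M..<M + q]"
  have xs: "length xs = q" "set xs = {M..<M + q}" "\<And>i. i < q \<Longrightarrow> xs ! i = M + i"
    by (auto simp: xs_def)
  define T' where "T' = \<lparr>verts = (verts T - {x}) \<union> set xs,
    edges = {e \<in> edges T. x \<notin> e} \<union> {{xs ! i, ys ! i} | i. i < length ys}
         \<union> {{xs ! i, xs ! Suc i} | i. Suc i < length xs}\<rparr>"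
  define V' where "V' t = (if M \<le> t then V x else V t)" for t
  have vT': "verts T' = (verts T - {x}) \<union> {M..<M + q}" by (simp add: T'_def xs)
  have eT': "edges T' = {e \<in> edges T. x \<notin> e} \<union> {{M + i, ys ! i} | i. i < q}
      \<union> {{M + i, M + Suc i} | i. Suc i < q}"
  proof -
    have "{{xs ! i, ys ! i} | i. i < length ys} = {{M + i, ys ! i} | i. i < q}"
      by (intro Collect_cong ex_cong1) (auto simp: xs(3) q_def)
    moreover have "{{xs ! i, xs ! Suc i} | i. Suc i < length xs} = {{M + i, M + Suc i} | i. Suc i < q}"
      by (intro Collect_cong ex_cong1) (auto simp: xs(1,3))
    ultimately show ?thesis unfolding T'_def by simp
  qed
  have disj: "(verts T - {x}) \<inter> {M..<M + q} = {}" using M by fastforce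
  have split: "split_vertex (T, V) (T', V')"
    unfolding split_vertex_def case_prod_conv
  proof (rule exI[of _ x], rule exI[of _ ys], rule exI[of _ xs], intro conjI)
    show "set xs \<inter> (verts T - {x}) = {}" using disj xs(2) by blast
    show "\<forall>t\<in>verts T - {x}. V' t = V t" using M by (fastforce simp: V'_def)
    show "\<forall>t\<in>set xs. V' t = V x" using xs(2) by (simp add: V'_def)
    show "4 \<le> length ys" "length xs = length ys" using q xs(1) by (simp_all add: q_def)
    show "distinct xs" by (simp add: xs_def)
  qed (simp_all add: x ys T'_def)
  define idx where "idx = inv_into {..<q} ((!) ys)"
  have inj: "inj_on ((!) ys) {..<q}" using ys by (simp add: inj_on_nth q_def)
  have idx1: "idx (ys ! i) = i" if "i < q" for i using inj that by (simp add: idx_def)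
  have idx2: "idx y < q \<and> ys ! idx y = y" if "y \<in> verts T" "y \<noteq> x" "up y = x" for y
  proof -
    have "y \<in> set ys" using that ys nbx by simp
    then obtain i where "i < q" "y = ys ! i" by (auto simp: in_set_conv_nth q_def)
    then show ?thesis using idx1 by simp
  qed
  have ysi: "ys ! i \<in> verts T \<and> ys ! i \<noteq> x \<and> up (ys ! i) = x" if "i < q" for i
  proof -
    have "ys ! i \<in> set ys" using that by (simp add: q_def)
    then show ?thesis using ys nbx by simp
  qed
  define up' where "up' v = (if M \<le> v then v - 1 else if up v = x then M + idx v else up v)" for v
  \<comment> \<open>The path takes the depths \<open>0\<close> to \<open>q - 1\<close>; shifting the
    old depths by \<open>q\<close> puts all other nodes below it.\<close>
  define depth' where "depth' v = (if M \<le> v then v - M else depth v + q)" for v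
  have rooted': "rooted_tree T' M up' depth'"
  proof
    show "finite (verts T')" "M \<in> verts T'" using fin q by (auto simp: vT')
    show "up' v \<in> verts T'" if v: "v \<in> verts T'" "v \<noteq> M" for v
    proof (cases "M \<le> v")
      case False
      then have "v \<in> verts T" "v \<noteq> x" using v by (auto simp: vT')
      then show ?thesis using False idx2[of v] R.up_in[of v] by (auto simp: up'_def vT')
    qed (use v in \<open>auto simp: up'_def vT' dest: M\<close>)
    show "depth' (up' v) < depth' v" if v: "v \<in> verts T'" "v \<noteq> M" for v
    proof (cases "M \<le> v")
      case False
      then have "v \<in> verts T" "v \<noteq> x" using v by (auto simp: vT')
      then show ?thesis using False idx2[of v] R.up_in[of v] R.depth_up[of v] M[of "up v"]
        by (auto simp: up'_def depth'_def)
    qed (use v in \<open>auto simp: up'_def depth'_def vT' dest: M\<close>)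
    show "edges T' = {{v, up' v} |v. v \<in> verts T' \<and> v \<noteq> M}" (is "_ = ?E")
    proof
      show "edges T' \<subseteq> ?E"
      proof
        fix e assume "e \<in> edges T'"
        then consider "e \<in> edges T" "x \<notin> e" | i where "i < q" "e = {M + i, ys ! i}"
          | i where "Suc i < q" "e = {M + i, M + Suc i}" unfolding eT' by blast
        then show "e \<in> ?E"
        proof cases
          case 1
          then obtain v where v: "v \<in> verts T" "v \<noteq> x" "e = {v, up v}" "up v \<noteq> x"
            unfolding R.edges_eq by auto
          then have "up' v = up v" using M[of v] by (simp add: up'_def)
          then show ?thesis using v M[of v] by (auto simp: vT')
        next
          case 2
          then have "ys ! i \<in> verts T'" "ys ! i \<noteq> M" "up' (ys ! i) = M + i"
            using ysi[of i] M[of "ys ! i"] idx1[of i] by (auto simp: vT' up'_def)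
          then show ?thesis using 2 by (auto intro!: exI[of _ "ys ! i"] simp: insert_commute)
        next
          case 3
          then have "M + Suc i \<in> verts T'" "M + Suc i \<noteq> M" "up' (M + Suc i) = M + i"
            by (auto simp: vT' up'_def)
          then show ?thesis using 3 by (auto intro!: exI[of _ "M + Suc i"] simp: insert_commute)
        qed
      qed
      show "?E \<subseteq> edges T'"
      proof
        fix e assume "e \<in> ?E"
        then obtain v where v: "e = {v, up' v}" "v \<in> verts T'" "v \<noteq> M" by blast
        show "e \<in> edges T'"
        proof (cases "M \<le> v")
          case True
          then have "v \<in> {M..<M + q}" using v M by (auto simp: vT' dest: M)
          define i where "i = v - Suc M"
          have "v = M + Suc i" "Suc i < q" using True v \<open>v \<in> {M..<M + q}\<close> by (auto simp: i_def)
          moreover then have "e = {M + i, M + Suc i}" using v by (auto simp: up'_def)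
          ultimately show ?thesis unfolding eT' by blast
        next
          case False
          then have vT: "v \<in> verts T" "v \<noteq> x" using v by (auto simp: vT')
          show ?thesis
          proof (cases "up v = x")
            case True
            then have "e = {M + idx v, ys ! idx v}" "idx v < q"
              using idx2[of v] vT False v by (auto simp: up'_def)
            then show ?thesis unfolding eT' by blast
          next
            case ne: False
            then have "e = {v, up v}" "x \<notin> e" using False v vT by (auto simp: up'_def)
            moreover have "{v, up v} \<in> edges T" using vT unfolding R.edges_eq by blast
            ultimately show ?thesis unfolding eT' by blast
          qed
        qed
      qed
    qed
  qed
  interpret R': rooted_tree T' M up' depth' by (rule rooted')
  have V'1: "V' t = V t" if "t \<in> verts T" for t using M[OF that] by (simp add: V'_def)
  have td': "verts G = (\<Union>t\<in>verts T. V t)" "\<And>e. e \<in> edges G \<Longrightarrow> \<exists>t\<in>verts T. e \<subseteq> V t"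
    "\<And>i s t. R.topmost {t \<in> verts T. i \<in> V t} s \<Longrightarrow> R.topmost {t \<in> verts T. i \<in> V t} t \<Longrightarrow> s = t"
    using td unfolding R.tree_decomposition_iff by blast+
  have V'M: "V' M = V x" "M \<in> verts T'" using q by (auto simp: V'_def vT')
  have bag: "\<exists>s\<in>verts T'. V' s = V t" if "t \<in> verts T" for t
    using V'M V'1[of t] that by (cases "t = x") (auto simp: vT')
  have bag': "\<exists>s\<in>verts T. V' t = V s" if "t \<in> verts T'" for t
    using that V'1[of t] x by (auto simp: vT' V'_def)
  have image: "V' ` verts T' = V ` verts T"
  proof
    show "V' ` verts T' \<subseteq> V ` verts T" using bag' by auto
    show "V ` verts T \<subseteq> V' ` verts T'"
    proof
      fix B assume "B \<in> V ` verts T"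
      then obtain t where "t \<in> verts T" "B = V t" by auto
      then obtain s where "s \<in> verts T'" "V' s = B" using bag by blast
      then show "B \<in> V' ` verts T'" by auto
    qed
  qed
  have "tree_decomposition G T' V'" unfolding R'.tree_decomposition_iff
  proof (intro conjI allI impI ballI)
    show "verts G = (\<Union>t\<in>verts T'. V' t)" using td'(1) image by simp
    show "\<exists>t\<in>verts T'. e \<subseteq> V' t" if "e \<in> edges G" for e using td'(2)[OF that] bag by metis
    fix i s t
    assume st: "R'.topmost {t \<in> verts T'. i \<in> V' t} s" "R'.topmost {t \<in> verts T'. i \<in> V' t} t"
    \<comment> \<open>An old node that is topmost in \<open>T'\<close> is topmost in
      \<open>T\<close>, and on the path only the first vertex \<open>M\<close> can be topmost, in
      which case \<open>x\<close> is topmost in \<open>T\<close>. Uniqueness in \<open>T\<close>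
      settles all cases; a mixed pair would make \<open>x\<close> a vertex of
      \<open>T'\<close>.\<close>
    have old: "R'.topmost {t \<in> verts T'. i \<in> V' t} t \<Longrightarrow> t < M \<Longrightarrow> R.topmost {t \<in> verts T. i \<in> V t} t" for t
    proof -
      assume t: "R'.topmost {t \<in> verts T'. i \<in> V' t} t" "t < M"
      then have tT: "t \<in> verts T" "t \<noteq> x" "i \<in> V t" by (auto simp: R'.topmost_def vT' V'_def)
      have "i \<notin> V (up t)"
      proof
        assume i: "i \<in> V (up t)"
        have "up' t \<in> verts T'" using R'.up_in tT t(2) by (auto simp: vT')
        moreover have "i \<in> V' (up' t)"
          using i t(2) tT V'1[OF R.up_in[of t]] idx2[of t] by (auto simp: up'_def V'_def)
        ultimately show False using t by (auto simp: R'.topmost_def)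
      qed
      then show "R.topmost {t \<in> verts T. i \<in> V t} t" using tT by (auto simp: R.topmost_def)
    qed
    have new: "R'.topmost {t \<in> verts T'. i \<in> V' t} t \<Longrightarrow> M \<le> t \<Longrightarrow> t = M \<and> R.topmost {t \<in> verts T. i \<in> V t} x" for t
    proof -
      assume t: "R'.topmost {t \<in> verts T'. i \<in> V' t} t" "M \<le> t"
      then have i: "i \<in> V x" "t \<in> verts T'" by (auto simp: R'.topmost_def V'_def)
      moreover have "t = M"
      proof (rule ccontr)
        assume "t \<noteq> M"
        then have "M \<le> up' t" using t by (auto simp: up'_def)
        moreover have "up' t \<in> verts T'" using R'.up_in i \<open>t \<noteq> M\<close> by blast
        ultimately show False using t i \<open>t \<noteq> M\<close> by (auto simp: R'.topmost_def V'_def)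
      qed
      ultimately show ?thesis using x by (auto simp: R.topmost_def)
    qed
    show "s = t"
    proof (cases "s < M"; cases "t < M")
      assume "s < M" "t < M"
      then show ?thesis using old st td'(3) by blast
    next
      assume *: "s < M" "\<not> t < M"
      then have "s = x" using old new st td'(3) by (meson not_less)
      then show ?thesis using st * by (auto simp: R'.topmost_def vT')
    next
      assume *: "\<not> s < M" "t < M"
      then have "t = x" using old new st td'(3) by (meson not_less)
      then show ?thesis using st * by (auto simp: R'.topmost_def vT')
    qed (use new st in \<open>metis not_less\<close>)
  qed
  \<comment> \<open>A neighbour of \<open>x\<close> exchanges \<open>x\<close> for exactly one
    vertex of the path.\<close>
  have deg_old: "vertex_degree T' t = vertex_degree T t" if t: "t \<in> verts T" "t \<noteq> x" for t
  proof -
    have nb: "y \<in> nbrs T' t \<longleftrightarrow> (y \<in> nbrs T t \<and> y \<noteq> x) \<or> (\<exists>i<q. t = ys ! i \<and> y = M + i)" for y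
      using t M[of t] unfolding nbrs_def eT' by (auto simp: doubleton_eq_iff)
    have fnb: "finite (nbrs T t)" "nbrs T t \<subseteq> verts T"
      using nbrs_subset[OF R.simple, of t] finite_subset[OF _ fin] by blast+
    show ?thesis
    proof (cases "up t = x")
      case True
      have "nbrs T' t = insert (M + idx t) (nbrs T t - {x})"
      proof (rule Set.set_eqI)
        fix y
        have "(\<exists>i<q. t = ys ! i \<and> y = M + i) \<longleftrightarrow> y = M + idx t"
          using idx1 idx2[of t] t True by auto
        then show "y \<in> nbrs T' t \<longleftrightarrow> y \<in> insert (M + idx t) (nbrs T t - {x})" using nb by auto
      qed
      moreover have "M + idx t \<notin> nbrs T t" using fnb M by fastforce
      moreover have "x \<in> nbrs T t" using R.nbrs_eq[OF t(1)] True t by auto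
      ultimately show ?thesis using fnb card_Suc_Diff1[of "nbrs T t" x]
        by (simp add: vertex_degree_def)
    next
      case False
      then have "\<not> (\<exists>i<q. t = ys ! i)" using ysi by auto
      moreover have "x \<notin> nbrs T t" using R.nbrs_eq[OF t(1)] False t by auto
      ultimately have "nbrs T' t = nbrs T t" using nb by auto
      then show ?thesis by (simp add: vertex_degree_def)
    qed
  qed
  \<comment> \<open>There is one old neighbour and there are at most two on the path. At the ends of
    the path the three candidates need not all be neighbours, as only an upper bound is
    wanted.\<close>
  have deg_new: "vertex_degree T' t \<le> 3" if t: "t \<in> {M..<M + q}" for t
  proof -
    have "t \<notin> verts T" using t M by fastforce
    have "nbrs T' t \<subseteq> {ys ! (t - M), t - 1, Suc t}"
    proof
      fix y assume "y \<in> nbrs T' t"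
      then have "{t, y} \<in> edges T'" by (simp add: nbrs_def)
      moreover have "{t, y} \<notin> edges T"
        using nbrs_subset[OF R.simple, of y] \<open>t \<notin> verts T\<close> by (auto simp: nbrs_def insert_commute)
      ultimately consider i where "i < q" "{t, y} = {M + i, ys ! i}"
        | i where "Suc i < q" "{t, y} = {M + i, M + Suc i}" unfolding eT' by blast
      then show "y \<in> {ys ! (t - M), t - 1, Suc t}"
        using ysi \<open>t \<notin> verts T\<close> by cases (auto simp: doubleton_eq_iff)
    qed
    then have "vertex_degree T' t \<le> card {ys ! (t - M), t - 1, Suc t}"
      unfolding vertex_degree_def by (rule card_mono[rotated]) simp
    also have "\<dots> \<le> 3" by (simp add: card_insert_if)
    finally show ?thesis .
  qed
  have "split_size T' = (\<Sum>t\<in>verts T - {x}. if 3 < vertex_degree T' t then vertex_degree T' t else 1)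
      + (\<Sum>t\<in>{M..<M + q}. if 3 < vertex_degree T' t then vertex_degree T' t else 1)"
    unfolding split_size_def vT' using fin disj by (intro sum.union_disjoint) auto
  also have "(\<Sum>t\<in>{M..<M + q}. if 3 < vertex_degree T' t then vertex_degree T' t else 1) =
      (\<Sum>t\<in>{M..<M + q}. 1)"
    using deg_new by (intro sum.cong refl) fastforce
  also have "(\<Sum>t\<in>verts T - {x}. if 3 < vertex_degree T' t then vertex_degree T' t else 1) =
      (\<Sum>t\<in>verts T - {x}. if 3 < vertex_degree T t then vertex_degree T t else 1)"
    using deg_old by (intro sum.cong) auto
  also have "\<dots> + (\<Sum>t\<in>{M..<M + q}. 1) = split_size T"
    unfolding split_size_def
    using sum.remove[OF fin x, of "\<lambda>t. if 3 < vertex_degree T t then vertex_degree T t else 1"] q by simp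
  finally have size: "split_size T' = split_size T" .
  have "{t \<in> verts T'. 3 < vertex_degree T' t} \<subseteq> {t \<in> verts T. 3 < vertex_degree T t} - {x}"
    using deg_old deg_new by (fastforce simp: vT')
  then have "{t \<in> verts T'. 3 < vertex_degree T' t} \<subset> {t \<in> verts T. 3 < vertex_degree T t}"
    using x deg by blast
  then have "card {t \<in> verts T'. 3 < vertex_degree T' t} < card {t \<in> verts T. 3 < vertex_degree T t}"
    using fin by (intro psubset_card_mono) auto
  then show ?thesis using split \<open>tree_decomposition G T' V'\<close> size image by blast
qed

text \<open>Induction on the number of nodes of degree above 3. The last conjunct is for paths: a
  tree that is already binary keeps its number of nodes.\<close>

lemma ex_split_vertices_binary:
  fixes T :: "nat ugraph"
  assumes "tree_decomposition G T V"
  shows "\<exists>T' V'. split_vertex\<^sup>*\<^sup>* (T, V) (T', V') \<and> tree_decomposition G T' V' \<and> is_binary T' \<and>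
    split_size T' = split_size T \<and> V' ` verts T' = V ` verts T \<and> (is_binary T \<longrightarrow> T' = T)"
  using assms
proof (induction "card {t \<in> verts T. 3 < vertex_degree T t}" arbitrary: T V rule: less_induct)
  case less
  show ?case
  proof (cases "is_binary T")
    case True
    then show ?thesis using less.prems by blast
  next
    case False
    then obtain x where "x \<in> verts T" "3 < vertex_degree T x" by (auto simp: is_binary_def not_le)
    then obtain T1 V1 where 1: "split_vertex (T, V) (T1, V1)" "tree_decomposition G T1 V1"
      "split_size T1 = split_size T" "V1 ` verts T1 = V ` verts T"
      "card {t \<in> verts T1. 3 < vertex_degree T1 t} < card {t \<in> verts T. 3 < vertex_degree T t}"
      using ex_split_vertex[OF less.prems] by blast
    obtain T' V' where 2: "split_vertex\<^sup>*\<^sup>* (T1, V1) (T', V')" "tree_decomposition G T' V'" "is_binary T'"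
      "split_size T' = split_size T1" "V' ` verts T' = V1 ` verts T1"
      using less.hyps[OF 1(5,2)] by blast
    have "split_vertex\<^sup>*\<^sup>* (T, V) (T', V')"
      using 1(1) 2(1) by (rule converse_rtranclp_into_rtranclp)
    then show ?thesis using 1(3,4) 2 False by auto
  qed
qed

lemma path_graph_degree:
  assumes "path_graph T"
  shows "vertex_degree T t \<le> 2"
proof -
  obtain xs where xs: "distinct xs" "edges T = {{xs ! i, xs ! Suc i} | i. Suc i < length xs}"
    using assms by (auto simp: path_graph_def)
  \<comment> \<open>At the ends of the list \<open>i - 1\<close> or \<open>Suc i\<close> may yield
    an entry that is no neighbour of \<open>t\<close>, which is harmless for an upper bound.\<close>
  let ?N = "if t \<in> set xs then (let i = (THE i. i < length xs \<and> xs ! i = t) in {xs ! (i - 1), xs ! Suc i}) else {}"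
  have "nbrs T t \<subseteq> ?N"
  proof
    fix y assume "y \<in> nbrs T t"
    then obtain i where i: "Suc i < length xs" "{t, y} = {xs ! i, xs ! Suc i}"
      using xs by (auto simp: nbrs_def)
    have the: "(THE i. i < length xs \<and> xs ! i = xs ! j) = j" if "j < length xs" for j
      using that xs(1) by (intro the_equality) (auto simp: nth_eq_iff_index_eq)
    show "y \<in> ?N"
      using i the[of i] the[of "Suc i"] by (auto simp: doubleton_eq_iff Let_def)
  qed
  then have "vertex_degree T t \<le> card ?N"
    unfolding vertex_degree_def by (rule card_mono[rotated]) (simp add: Let_def)
  also have "\<dots> \<le> 2" by (simp add: Let_def card_insert_if)
  finally show ?thesis .
qed

text \<open>The leaf is chosen after the splitting, and the final relabelling names it
  \<open>k - 1\<close>. In a path no vertex is split, which gives the exact count.\<close>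

lemma ex_binary_splitting:
  fixes T :: "'t ugraph"
  assumes td: "tree_decomposition G T V"
  shows "\<exists>k T' V'. binary_splitting T V k T' V' \<and> tree_decomposition G T' V' \<and>
    verts T' = {0..<k} \<and> 0 < k \<and> k \<le> 2 * card (verts T) \<and> V' ` verts T' = V ` verts T \<and>
    vertex_degree T' (k - 1) \<le> 1 \<and> is_binary T' \<and>
    (path_graph T \<longrightarrow> k = card (verts T) \<and> (\<forall>t\<in>verts T'. vertex_degree T' t \<le> 2))"
proof -
  note fin = tree_decomposition_finite[OF td]
  obtain r up depth where "rooted_tree T r up depth" using tree_decomposition_rooted[OF td] fin(2) by blast
  then interpret R: rooted_tree T r up depth .
  obtain f where f: "bij_betw f (verts T) {0..<card (verts T)}"
    using ex_bij_betw_finite_nat[OF fin(1)] by blast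
  define T0 where "T0 = \<lparr>verts = {0..<card (verts T)}, edges = (\<lambda>e. f ` e) ` edges T\<rparr>"
  define V0 where "V0 t = V (inv_into (verts T) f t)" for t
  have inj: "inj_on f (verts T)" using f by (auto simp: bij_betw_def)
  have f': "bij_betw f (verts T) (verts T0)" and e0: "edges T0 = (\<lambda>e. f ` e) ` edges T"
    using f by (auto simp: T0_def)
  have V0: "V0 (f t) = V t" if "t \<in> verts T" for t using inj that by (simp add: V0_def)
  have rel0: "relabelling (T, V) (T0, V0)"
    using f' e0 V0 by (auto simp: relabelling_def)
  have td0: "tree_decomposition G T0 V0" by (rule relabelling_tree_decomposition[OF td f' e0 V0])
  have deg0: "vertex_degree T0 (f t) = vertex_degree T t" if "t \<in> verts T" for t
    by (rule relabelling_degree[OF fin(3) inj that e0])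
  have im0: "verts T0 = f ` verts T" using f' by (auto simp: bij_betw_def)
  have size0: "split_size T0 = split_size T"
    unfolding split_size_def im0 sum.reindex[OF inj] using deg0 by (intro sum.cong) auto
  have bags0: "V0 ` verts T0 = V ` verts T" unfolding im0 image_image using V0 by auto
  obtain T1 V1 where 1: "split_vertex\<^sup>*\<^sup>* (T0, V0) (T1, V1)" "tree_decomposition G T1 V1"
    "is_binary T1" "split_size T1 = split_size T0" "V1 ` verts T1 = V0 ` verts T0"
    "is_binary T0 \<longrightarrow> T1 = T0"
    using ex_split_vertices_binary[OF td0] by blast
  note fin1 = tree_decomposition_finite[OF 1(2)]
  obtain r1 up1 depth1 where "rooted_tree T1 r1 up1 depth1" using tree_decomposition_rooted[OF 1(2)] fin1(2) by blast
  then obtain y where y: "y \<in> verts T1" "vertex_degree T1 y \<le> 1"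
    using rooted_tree.ex_leaf by metis
  define k where "k = card (verts T1)"
  have k: "0 < k" "k \<le> 2 * card (verts T)"
    using fin1 card_le_split_size[of T1] 1(4) size0 R.split_size_le by (auto simp: k_def card_gt_0_iff)
  have "card (verts T1 - {y}) = k - 1" using y fin1 by (simp add: k_def)
  then obtain h where h: "bij_betw h (verts T1 - {y}) {0..<k - 1}"
    using ex_bij_betw_finite_nat[of "verts T1 - {y}"] fin1 by auto
  define g where "g v = (if v = y then k - 1 else h v)" for v
  have "bij_betw g (verts T1 - {y}) {0..<k - 1}" using h by (subst bij_betw_cong[of _ _ h]) (auto simp: g_def)
  then have "bij_betw g (insert y (verts T1 - {y})) (insert (k - 1) {0..<k - 1})"
    using notIn_Un_bij_betw[of y "verts T1 - {y}" g "{0..<k - 1}"] by (simp add: g_def)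
  moreover have "insert y (verts T1 - {y}) = verts T1" "insert (k - 1) {0..<k - 1} = {0..<k}"
    using y k by auto
  ultimately have g: "bij_betw g (verts T1) {0..<k}" by simp
  define T2 where "T2 = \<lparr>verts = {0..<k}, edges = (\<lambda>e. g ` e) ` edges T1\<rparr>"
  define V2 where "V2 t = V1 (inv_into (verts T1) g t)" for t
  have injg: "inj_on g (verts T1)" using g by (auto simp: bij_betw_def)
  have g': "bij_betw g (verts T1) (verts T2)" and e2: "edges T2 = (\<lambda>e. g ` e) ` edges T1"
    using g by (auto simp: T2_def)
  have V2: "V2 (g t) = V1 t" if "t \<in> verts T1" for t using injg that by (simp add: V2_def)
  have rel2: "relabelling (T1, V1) (T2, V2)" using g' e2 V2 by (auto simp: relabelling_def)
  have td2: "tree_decomposition G T2 V2" by (rule relabelling_tree_decomposition[OF 1(2) g' e2 V2])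
  have deg2: "vertex_degree T2 (g t) = vertex_degree T1 t" if "t \<in> verts T1" for t
    by (rule relabelling_degree[OF fin1(3) injg that e2])
  have im2: "verts T2 = g ` verts T1" using g' by (auto simp: bij_betw_def)
  have bags2: "V2 ` verts T2 = V ` verts T"
    unfolding 1(5)[symmetric] bags0[symmetric] im2 image_image using V2 by auto
  have root: "vertex_degree T2 (k - 1) \<le> 1" using deg2[OF y(1)] y(2) by (simp add: g_def)
  have bin2: "is_binary T2" using 1(3) deg2 by (auto simp: is_binary_def im2)
  have "k = card (verts T) \<and> (\<forall>t\<in>verts T2. vertex_degree T2 t \<le> 2)" if path: "path_graph T"
  proof -
    have d: "vertex_degree T0 t \<le> 2" if "t \<in> verts T0" for t
      using deg0 path_graph_degree[OF path] that by (auto simp: im0)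
    then have "T1 = T0" using 1(6) by (fastforce simp: is_binary_def)
    then show ?thesis using d deg2 by (auto simp: im2 k_def T0_def)
  qed
  moreover have "binary_splitting T V k T2 V2"
    unfolding binary_splitting_def using rel0 1(1,3) rel2 by (force simp: T2_def)
  moreover have "verts T2 = {0..<k}" by (simp add: T2_def)
  ultimately show ?thesis using td2 k bags2 root bin2 by blast
qed

section \<open>Low-rank factors\<close>

text \<open>A maximal independent set of columns spans the column space, since a column outside its
  span could be added. The set is returned as a list because \<open>gram_schmidt\<close> works on
  lists.\<close>

lemma ex_maximal_independent_columns:
  fixes M :: "real mat"
  assumes "M \<in> carrier_mat n c"
  shows "\<exists>ws. distinct ws \<and> set ws \<subseteq> set (cols M) \<and> \<not> module.lin_dep class_ring (module_vec TYPE(real) n) (set ws) \<and>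
    length ws = vec_space.rank n M \<and>
    LinearCombinations.module.span class_ring (module_vec TYPE(real) n) (set ws) = vec_space.col_space n M"
proof -
  interpret vec_space "TYPE(real)" n .
  have C: "set (cols M) \<subseteq> carrier_vec n" using assms cols_dim by blast
  have "lin_indpt {}" by (auto simp: lin_dep_def)
  then obtain U where U: "finite U" "maximal U (\<lambda>T. T \<subseteq> set (cols M) \<and> lin_indpt T)"
    using maximal_exists_superset[of "set (cols M)" "\<lambda>T. T \<subseteq> set (cols M) \<and> lin_indpt T" "{}"] by auto
  then have U': "U \<subseteq> set (cols M)" "lin_indpt U" by (auto simp: maximal_def)
  have "x \<in> span U" if "x \<in> set (cols M)" for x
  proof (rule ccontr)
    assume x: "x \<notin> span U"
    moreover have "U \<subseteq> span U" using in_own_span[of U] U'(1) C by simp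
    ultimately have "x \<notin> U" by blast
    have "lin_indpt (insert x U)"
      using lin_dep_iff_in_span[of U x] x \<open>x \<notin> U\<close> U' C that by auto
    moreover have "insert x U \<subseteq> set (cols M)" using that U'(1) by simp
    ultimately have "insert x U = U"
      using U(2)[unfolded maximal_def, THEN conjunct2, THEN spec, of "insert x U"] by auto
    then show False using \<open>x \<notin> U\<close> by blast
  qed
  then have "set (cols M) \<subseteq> span U" by blast
  then have "span (set (cols M)) = span U"
    using span_subsetI[of U "set (cols M)"] span_is_monotone[OF U'(1)] U'(1) C by (meson subset_antisym subset_trans)
  moreover obtain ws where "set ws = U" "distinct ws" using finite_distinct_list[OF U(1)] by blast
  moreover have "rank M = card U" using rank_card_indpt[OF assms U(2)] .
  ultimately show ?thesis using U' by (intro exI[of _ ws]) (auto simp: col_space_def distinct_card)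
qed

text \<open>
  With orthogonal columns \<open>a\<^sub>i\<close>, the row \<open>i\<close> of the generalized inverse is \<open>a\<^sub>i / (a\<^sub>i \<bullet> a\<^sub>i)\<close>,
  which is \<open>0\<close> for the zero columns added as padding.
\<close>

lemma ex_factor_with_generalized_inverse:
  fixes M :: "real mat"
  assumes M: "M \<in> carrier_mat n c" and rank: "vec_space.rank n M \<le> l"
  shows "\<exists>A L. A \<in> carrier_mat n l \<and> L \<in> carrier_mat l n \<and>
    vec_space.col_space n A = vec_space.col_space n M \<and> A * L * A = A"
proof -
  interpret cof_vec_space n "TYPE(real)" .
  obtain ws where ws: "distinct ws" "set ws \<subseteq> set (cols M)" "lin_indpt (set ws)"
      "length ws = rank M" "span (set ws) = col_space M"
    using ex_maximal_independent_columns[OF M] by blast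
  have wsC: "set ws \<subseteq> carrier_vec n" using ws M cols_dim by blast
  define us where "us = gram_schmidt n ws"
  have us: "span (set us) = col_space M" "corthogonal us" "set us \<subseteq> carrier_vec n"
      "length us = rank M"
    using gram_schmidt_result[OF wsC ws(1,3) us_def] ws by auto
  define bs where "bs = us @ replicate (l - rank M) (0\<^sub>v n)"
  have len: "length bs = l" using us rank by (simp add: bs_def)
  have bsC: "set bs \<subseteq> carrier_vec n" using us by (auto simp: bs_def)
  define A where "A = mat_of_cols n bs"
  have A: "A \<in> carrier_mat n l" using len by (auto simp: A_def)
  have ip: "col A i \<bullet> col A j = 0" if "i < l" "j < l" "i \<noteq> j" for i j
  proof -
    have "col A k = bs ! k" if "k < l" for k
      using that len bsC nth_mem[of k bs] by (auto simp: A_def subset_iff intro: col_mat_of_cols)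
    then show ?thesis using that us(2,3) corthogonalD[OF us(2), of i j] len
      by (auto simp: bs_def nth_append subset_iff)
  qed
  have "span (set bs) = span (set us)"
  proof
    have "0\<^sub>v n \<in> span (set us)" by (rule in_spanI[of _ "\<lambda>_. 0" "{}"]) (auto simp: lincomb_def)
    then show "span (set bs) \<subseteq> span (set us)"
      using us in_own_span[of "set us"] by (intro span_subsetI) (auto simp: bs_def)
    show "span (set us) \<subseteq> span (set bs)" by (rule span_is_monotone) (auto simp: bs_def)
  qed
  moreover have "cols A = bs" using bsC by (simp add: A_def)
  ultimately have col: "col_space A = col_space M" using us by (simp add: col_space_def)
  define L where "L = mat l n (\<lambda>(i, k). A $$ (k, i) / (col A i \<bullet> col A i))"
  have L: "L \<in> carrier_mat l n" by (simp add: L_def)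
  \<comment> \<open>\<open>L * A\<close> is diagonal, with entry 0 at the zero columns of
    \<open>A\<close> and 1 elsewhere, so multiplying \<open>A\<close> by it on the right changes
    nothing.\<close>
  have LA: "(L * A) $$ (i, j) = (if i = j \<and> col A i \<bullet> col A i \<noteq> 0 then 1 else 0)"
    if "i < l" "j < l" for i j
  proof -
    have "(L * A) $$ (i, j) = (\<Sum>k<n. A $$ (k, i) / (col A i \<bullet> col A i) * A $$ (k, j))"
      using that A by (auto simp: L_def scalar_prod_def atLeast0LessThan)
    also have "\<dots> = (col A i \<bullet> col A j) / (col A i \<bullet> col A i)"
      using that A by (simp add: scalar_prod_def atLeast0LessThan sum_divide_distrib)
    finally show ?thesis using ip that by auto
  qed
  have zero: "A $$ (k, j) = 0" if "col A j \<bullet> col A j = 0" "k < n" "j < l" for k j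
  proof -
    have "(\<Sum>k<n. A $$ (k, j) * A $$ (k, j)) = 0"
      using that A by (simp add: scalar_prod_def atLeast0LessThan)
    then show ?thesis using that by (subst (asm) sum_nonneg_eq_0_iff) auto
  qed
  have "A * (L * A) = A"
  proof (rule eq_matI)
    fix k j assume "k < dim_row A" "j < dim_col A"
    then have kj: "k < n" "j < l" using A by auto
    then have "(A * (L * A)) $$ (k, j) = (\<Sum>i<l. A $$ (k, i) * (L * A) $$ (i, j))"
      using A L by (simp add: scalar_prod_def atLeast0LessThan)
    also have "\<dots> = (\<Sum>i<l. if i = j then A $$ (k, i) * (if col A j \<bullet> col A j \<noteq> 0 then 1 else 0) else 0)"
      by (rule sum.cong) (use LA kj in auto)
    also have "\<dots> = A $$ (k, j)" using kj zero by auto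
    finally show "(A * (L * A)) $$ (k, j) = A $$ (k, j)" .
  qed (use A L in auto)
  then have "A * L * A = A" using A L by (simp add: assoc_mult_mat[of A n l L n A l])
  then show ?thesis using A L col by blast
qed

lemma concat_cols_carrier:
  "concat_cols n m M \<in> carrier_mat n (length (concat (map (\<lambda>i. cols (M i)) [0..<Suc m])))"
  unfolding concat_cols_def by (rule mat_of_cols_carrier)

lemma col_in_col_space_concat_cols:
  fixes M :: "nat \<Rightarrow> real mat"
  assumes M: "\<forall>i\<in>{0..m}. M i \<in> carrier_mat n n" and i: "i \<le> m" and j: "j < n"
  shows "col (M i) j \<in> vec_space.col_space n (concat_cols n m M)"
proof -
  interpret vec_space "TYPE(real)" n .
  let ?bs = "concat (map (\<lambda>i. cols (M i)) [0..<Suc m])"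
  have c: "set ?bs \<subseteq> carrier_vec n"
  proof
    fix x assume "x \<in> set ?bs"
    then obtain k where "k \<le> m" "x \<in> set (cols (M k))"
      by (auto simp: less_Suc_eq_le simp del: upt_Suc)
    moreover have "M k \<in> carrier_mat n n" using M \<open>k \<le> m\<close> by simp
    ultimately show "x \<in> carrier_vec n" using cols_dim[of "M k"] by auto
  qed
  have "dim_col (M i) = n" using M i by auto
  then have "col (M i) j \<in> set (cols (M i))" using j by (auto simp: cols_def)
  then have "col (M i) j \<in> set ?bs" using i by (auto simp: less_Suc_eq_le simp del: upt_Suc)
  moreover have "cols (concat_cols n m M) = ?bs"
    unfolding concat_cols_def using c by (rule cols_mat_of_cols)
  ultimately show ?thesis using span_mem[of "set ?bs"] c unfolding col_space_def by auto
qed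

text \<open>\<open>Al i\<close> is symmetric, as the difference of two symmetric matrices.
  \<open>A * L\<close> fixes the column space of \<open>A\<close> and hence the columns of
  \<open>Al i\<close>; transposing, \<open>L\<^sup>T * A\<^sup>T\<close> can be absorbed on the
  right as well. So \<open>S i = L * Al i * L\<^sup>T\<close> works.\<close>

lemma ex_low_rank_factors:
  assumes wf: "wf_sdp P" and splr: "splr_decomposition P G l As Al"
  shows "\<exists>A S. low_rank_factors P l Al A S"
proof -
  let ?n = "sdp_dim P" and ?m = "sdp_ncons P"
  interpret vec_space "TYPE(real)" ?n .
  have Al: "Al i \<in> carrier_mat ?n ?n" if "i \<le> ?m" for i
    using splr that by (auto simp: splr_decomposition_def)
  have sym: "(Al i)\<^sup>T = Al i" if i: "i \<le> ?m" for i
  proof -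
    have "As i \<in> carrier_mat ?n ?n" "(As i)\<^sup>T = As i" "sdp_mat P i = As i + Al i"
      using splr i by (auto simp: splr_decomposition_def sparse_sym_mats_def sym_mats_def)
    moreover have "(sdp_mat P i)\<^sup>T = sdp_mat P i"
      using wf i by (auto simp: wf_sdp_def sym_mats_def)
    ultimately have *: "(As i + Al i)\<^sup>T $$ (a, b) = (As i + Al i) $$ (a, b)"
      "(As i)\<^sup>T $$ (a, b) = As i $$ (a, b)" for a b by auto
    show ?thesis
    proof (rule eq_matI)
      fix a b assume "a < dim_row (Al i)" "b < dim_col (Al i)"
      then show "(Al i)\<^sup>T $$ (a, b) = Al i $$ (a, b)"
        using *[of a b] Al[OF i] \<open>As i \<in> carrier_mat ?n ?n\<close> by simp
    qed (use Al[OF i] in auto)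
  qed
  have rk: "rank (concat_cols ?n ?m Al) \<le> l" using splr by (simp add: splr_decomposition_def)
  obtain A L where A: "A \<in> carrier_mat ?n l" and L: "L \<in> carrier_mat l ?n"
    and col: "col_space A = col_space (concat_cols ?n ?m Al)" and inv: "A * L * A = A"
    using ex_factor_with_generalized_inverse[OF concat_cols_carrier rk] by blast
  define S where "S i = L * Al i * L\<^sup>T" for i
  have "S i \<in> sym_mats l \<and> Al i = A * S i * A\<^sup>T" if i: "i \<le> ?m" for i
  proof
    have [simp]: "L \<in> carrier_mat l ?n" "Al i \<in> carrier_mat ?n ?n" "A \<in> carrier_mat ?n l"
      "L\<^sup>T \<in> carrier_mat ?n l" "A\<^sup>T \<in> carrier_mat l ?n" "A * L \<in> carrier_mat ?n ?n"
      "L\<^sup>T * A\<^sup>T \<in> carrier_mat ?n ?n"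
      using A L Al[OF i] by auto
    have "(S i)\<^sup>T = (L\<^sup>T)\<^sup>T * (L * Al i)\<^sup>T"
      unfolding S_def by (rule transpose_mult[of _ l ?n _ l]) (auto intro: mult_carrier_mat[of _ _ ?n])
    also have "(L * Al i)\<^sup>T = Al i * L\<^sup>T"
      using transpose_mult[of L l ?n "Al i" ?n] sym[OF i] by simp
    finally have "(S i)\<^sup>T = L * (Al i * L\<^sup>T)" by simp
    moreover have "L * Al i * L\<^sup>T = L * (Al i * L\<^sup>T)"
      by (rule assoc_mult_mat[of _ l ?n _ ?n _ l]) auto
    moreover have "L * (Al i * L\<^sup>T) \<in> carrier_mat l l"
      by (intro mult_carrier_mat[of _ _ ?n]) auto
    ultimately show "S i \<in> sym_mats l" by (simp add: sym_mats_def S_def)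
    have left: "A * L * Al i = Al i"
    proof (rule mat_col_eqI)
      fix j assume "j < dim_col (Al i)"
      then have j: "j < ?n" using Al[OF i] by auto
      have "col (Al i) j \<in> col_space A"
        using col_in_col_space_concat_cols[of ?m Al ?n i j] Al i j col by auto
      then obtain x where x: "x \<in> carrier_vec l" "A *\<^sub>v x = col (Al i) j"
        using col_space_eq[OF A] A by auto
      have "col (A * L * Al i) j = (A * L) *\<^sub>v (A *\<^sub>v x)"
        using j x col_mult2[of "A * L" ?n ?n "Al i" ?n j] by simp
      also have "\<dots> = (A * L * A) *\<^sub>v x" using x A by (simp add: assoc_mult_mat_vec[of _ ?n ?n A l])
      finally show "col (A * L * Al i) j = col (Al i) j" using inv x by simp
    qed (use carrier_matD[OF A] carrier_matD[OF Al[OF i]] in simp_all)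
    have "Al i * (L\<^sup>T * A\<^sup>T) = (A * L * Al i)\<^sup>T"
      using sym[OF i] transpose_mult[of "A * L" ?n ?n "Al i" ?n] transpose_mult[of A ?n l L ?n] by simp
    then have right: "Al i * (L\<^sup>T * A\<^sup>T) = Al i" using left sym[OF i] by simp
    have "A * S i * A\<^sup>T = A * L * Al i * (L\<^sup>T * A\<^sup>T)"
      using A L Al[OF i] unfolding S_def
      by (smt (verit) assoc_mult_mat mult_carrier_mat transpose_carrier_mat)
    then show "Al i = A * S i * A\<^sup>T" using left right by simp
  qed
  then have "low_rank_factors P l Al A S" using A col by (auto simp: low_rank_factors_def)
  then show ?thesis by blast
qed

section \<open>Trace inner products and positive semidefinite matrices\<close>

lemma trace_inner_eq:
  assumes "A \<in> carrier_mat n n" "B \<in> carrier_mat n n"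
  shows "trace_inner A B = (\<Sum>i<n. \<Sum>j<n. A $$ (i, j) * B $$ (i, j))"
proof -
  have "trace_inner A B = (\<Sum>i<n. \<Sum>j<n. A $$ (j, i) * B $$ (j, i))"
    using assms unfolding trace_inner_def
    by (intro sum.cong) (auto simp: scalar_prod_def atLeast0LessThan)
  then show ?thesis by (subst sum.swap)
qed

text \<open>Functions instead of vectors let \<open>a_ext\<close> and \<open>lift\<close> be
  inserted directly; only their values below \<open>n\<close> matter.\<close>

definition bilin :: "real mat \<Rightarrow> nat \<Rightarrow> (nat \<Rightarrow> real) \<Rightarrow> (nat \<Rightarrow> real) \<Rightarrow> real" where
  "bilin X n u v = (\<Sum>i<n. \<Sum>j<n. u i * X $$ (i, j) * v j)"

lemma bilin_vec:
  assumes "X \<in> carrier_mat n n" "v \<in> carrier_vec n"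
  shows "v \<bullet> (X *\<^sub>v v) = bilin X n (\<lambda>i. v $ i) (\<lambda>i. v $ i)"
proof -
  have "v \<bullet> (X *\<^sub>v v) = (\<Sum>i<n. v $ i * (\<Sum>j<n. X $$ (i, j) * v $ j))"
    using assms by (auto simp: scalar_prod_def atLeast0LessThan intro!: sum.cong)
  then show ?thesis by (simp add: bilin_def sum_distrib_left mult.assoc)
qed

lemma psd_mats_iff:
  "X \<in> psd_mats n \<longleftrightarrow> X \<in> sym_mats n \<and> (\<forall>v. 0 \<le> bilin X n v v)"
proof -
  have "bilin X n v v = bilin X n (\<lambda>i. vec n v $ i) (\<lambda>i. vec n v $ i)" for v
    unfolding bilin_def by (intro sum.cong) auto
  then show ?thesis unfolding psd_mats_def sym_mats_def
    using bilin_vec[of X n] vec_carrier[of n] by (smt (verit) mem_Collect_eq)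
qed

lemma sym_mats_nth: "X \<in> sym_mats n \<Longrightarrow> i < n \<Longrightarrow> j < n \<Longrightarrow> X $$ (i, j) = X $$ (j, i)"
  unfolding sym_mats_def by (metis (mono_tags, lifting) carrier_matD index_transpose_mat(1) mem_Collect_eq)

lemma sym_matsI:
  assumes "X \<in> carrier_mat n n" "\<And>i j. i < n \<Longrightarrow> j < n \<Longrightarrow> X $$ (i, j) = X $$ (j, i)"
  shows "X \<in> sym_mats n"
  using assms by (auto simp: sym_mats_def intro!: eq_matI)

lemma sum_of_bool_left: "a < (n::nat) \<Longrightarrow> (\<Sum>i<n. of_bool (i = a) * f i) = (f a :: real)"
  by (simp add: of_bool_def if_distrib[of "\<lambda>x. x * _"] cong: if_cong)

lemma sum_of_bool_right: "a < (n::nat) \<Longrightarrow> (\<Sum>i<n. f i * of_bool (i = a)) = (f a :: real)"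
  by (simp add: of_bool_def if_distrib[of "\<lambda>x. _ * x"] cong: if_cong)

text \<open>Where the form vanishes at \<open>v\<close>, its value at \<open>v + s * e\<close> is
  \<open>2 * s * w + s\<^sup>2 * c\<close>, with \<open>w\<close> the entry to be shown zero. A
  nonzero \<open>w\<close> would make this negative for a small \<open>s\<close> of the opposite
  sign.\<close>

lemma psd_kernel:
  assumes X: "X \<in> psd_mats n" and zero: "bilin X n v v = 0" and a: "a < n"
  shows "(\<Sum>b<n. X $$ (a, b) * v b) = 0"
proof -
  define e :: "nat \<Rightarrow> real" where "e i = of_bool (i = a)" for i
  define w where "w = (\<Sum>b<n. X $$ (a, b) * v b)"
  define c where "c = X $$ (a, a)"
  have ev: "bilin X n e v = w"
  proof -
    have "bilin X n e v = (\<Sum>i<n. of_bool (i = a) * (\<Sum>j<n. X $$ (i, j) * v j))"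
      by (simp add: bilin_def e_def sum_distrib_left mult.assoc)
    then show ?thesis using sum_of_bool_left[OF a] by (simp add: w_def)
  qed
  have ve: "bilin X n v e = w"
  proof -
    have "bilin X n v e = (\<Sum>i<n. v i * X $$ (i, a))"
      unfolding bilin_def e_def using sum_of_bool_right[OF a] by simp
    also have "\<dots> = w" unfolding w_def using X a
      by (intro sum.cong) (auto simp: psd_mats_iff sym_mats_nth)
    finally show ?thesis .
  qed
  have ee: "bilin X n e e = c"
    unfolding bilin_def e_def using sum_of_bool_right[OF a] sum_of_bool_left[OF a] by (simp add: c_def)
  have "0 \<le> 2 * s * w + s\<^sup>2 * c" for s
  proof -
    have "bilin X n (\<lambda>i. v i + s * e i) (\<lambda>i. v i + s * e i)
        = bilin X n v v + s * bilin X n v e + s * bilin X n e v + s\<^sup>2 * bilin X n e e"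
      unfolding bilin_def sum_distrib_left sum.distrib[symmetric]
      by (intro sum.cong) (auto simp: algebra_simps power2_eq_square)
    also have "\<dots> = 2 * s * w + s\<^sup>2 * c" using zero ev ve ee by simp
    finally show ?thesis using X by (metis psd_mats_iff)
  qed
  note nonneg = this
  \<comment> \<open>With \<open>s = - w / q\<close> and denominators cleared, the value is
    \<open>- (w\<^sup>2 * (2 * q - c))\<close>; this \<open>q\<close> is positive and exceeds
    \<open>c / 2\<close> whatever the sign of \<open>c\<close>.\<close>
  define q where "q = \<bar>c\<bar> + 1"
  have q: "0 < q" "0 < 2 * q - c" by (auto simp: q_def)
  have "0 \<le> (2 * (- w / q) * w + (- w / q)\<^sup>2 * c) * q\<^sup>2" using nonneg[of "- w / q"] by simp
  also have "\<dots> = - (w\<^sup>2 * (2 * q - c))"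
    using q(1) by (simp add: field_simps power2_eq_square)
  finally have "w\<^sup>2 * (2 * q - c) \<le> 0" by simp
  with q(2) have "w\<^sup>2 \<le> 0" by (simp add: mult_le_0_iff)
  then show ?thesis by (simp add: w_def)
qed

section \<open>Submatrices on intervals and sums over blocks of indices\<close>

lemma pick_interval: "i < w \<Longrightarrow> pick {a..<a + w} i = a + i"
proof (induction i)
  case 0
  then show ?case by (auto intro!: Least_equality)
next
  case (Suc i)
  then have "pick {a..<a + w} i = a + i" by simp
  then show ?case using Suc.prems by (auto intro!: Least_equality)
qed

text \<open>\<open>submatrix\<close> numbers its rows through \<open>pick\<close>, which is a shift
  on an interval; the index sets \<open>I\<close> and \<open>J\<close> of form (E) are
  intervals.\<close>

lemma submatrix_interval:
  assumes "X \<in> carrier_mat N N" "a + w \<le> N"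
  shows "submatrix X {a..<a + w} {a..<a + w} = mat w w (\<lambda>(i, j). X $$ (a + i, a + j))"
proof -
  have "{i. i < N \<and> i \<in> {a..<a + w}} = {a..<a + w}" using assms by auto
  then show ?thesis using assms unfolding submatrix_def
    by (intro eq_matI) (auto simp: pick_interval simp del: atLeastLessThan_iff pick.simps)
qed

lemma sum_nested_intervals:
  fixes f :: "nat \<Rightarrow> real"
  shows "(\<Sum>b<n + k * l. f b) = (\<Sum>b<n. f b) + (\<Sum>s<k. \<Sum>g<l. f (n + s * l + g))"
proof -
  have "(\<Sum>b<n + k * l. f b) = (\<Sum>b<n. f b) + (\<Sum>b\<in>{n..<n + k * l}. f b)"
    using sum.atLeastLessThan_concat[of 0 n "n + k * l" f] by (simp add: atLeast0LessThan)
  also have "(\<Sum>b\<in>{n..<n + k * l}. f b) = (\<Sum>b<k * l. f (n + b))"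
    using sum.shift_bounds_nat_ivl[of f 0 n "k * l"] by (simp add: atLeast0LessThan add.commute)
  also have "\<dots> = (\<Sum>s<k. sum (\<lambda>b. f (n + b)) {s * l..<s * l + l})"
    by (rule sum.nat_group[symmetric])
  also have "\<dots> = (\<Sum>s<k. \<Sum>g<l. f (n + s * l + g))"
  proof (rule sum.cong[OF refl])
    fix s
    show "sum (\<lambda>b. f (n + b)) {s * l..<s * l + l} = (\<Sum>g<l. f (n + s * l + g))"
      using sum.shift_bounds_nat_ivl[of "\<lambda>b. f (n + b)" 0 "s * l" l]
      by (simp add: atLeast0LessThan ac_simps)
  qed
  finally show ?thesis .
qed

lemma sum_swap4:
  fixes f :: "nat \<Rightarrow> nat \<Rightarrow> nat \<Rightarrow> nat \<Rightarrow> real"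
  shows "(\<Sum>a\<in>A. \<Sum>b\<in>B. \<Sum>c\<in>C. \<Sum>d\<in>D. f a b c d) = (\<Sum>c\<in>C. \<Sum>d\<in>D. \<Sum>a\<in>A. \<Sum>b\<in>B. f a b c d)"
proof -
  have "(\<Sum>a\<in>A. \<Sum>b\<in>B. \<Sum>c\<in>C. \<Sum>d\<in>D. f a b c d) = (\<Sum>a\<in>A. \<Sum>c\<in>C. \<Sum>b\<in>B. \<Sum>d\<in>D. f a b c d)"
    by (rule sum.cong[OF refl], rule sum.swap)
  also have "\<dots> = (\<Sum>c\<in>C. \<Sum>a\<in>A. \<Sum>b\<in>B. \<Sum>d\<in>D. f a b c d)"
    by (rule sum.swap)
  also have "\<dots> = (\<Sum>c\<in>C. \<Sum>a\<in>A. \<Sum>d\<in>D. \<Sum>b\<in>B. f a b c d)"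
    by (rule sum.cong[OF refl], rule sum.cong[OF refl], rule sum.swap)
  also have "\<dots> = (\<Sum>c\<in>C. \<Sum>d\<in>D. \<Sum>a\<in>A. \<Sum>b\<in>B. f a b c d)"
    by (rule sum.cong[OF refl], rule sum.swap)
  finally show ?thesis .
qed

lemma sum_square_cong_support:
  fixes f :: "nat \<Rightarrow> nat \<Rightarrow> real"
  assumes "finite B" "A \<subseteq> B" "\<And>a b. a \<notin> A \<or> b \<notin> A \<Longrightarrow> f a b = 0"
  shows "(\<Sum>a\<in>A. \<Sum>b\<in>A. f a b) = (\<Sum>a\<in>B. \<Sum>b\<in>B. f a b)"
proof -
  have "(\<Sum>a\<in>A. \<Sum>b\<in>A. f a b) = (\<Sum>a\<in>A. \<Sum>b\<in>B. f a b)"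
    using assms by (intro sum.cong sum.mono_neutral_left) auto
  also have "\<dots> = (\<Sum>a\<in>B. \<Sum>b\<in>B. f a b)"
    using assms by (intro sum.mono_neutral_left) (auto intro: sum.neutral)
  finally show ?thesis .
qed

text \<open>This is \<open>\<langle>A S A\<^sup>T, X\<rangle> = \<langle>S, A\<^sup>T X
  A\<rangle>\<close>, with the right-hand side spelled out so that it can be compared with the root
  block entry by entry.\<close>

lemma trace_inner_congruence:
  assumes A: "A \<in> carrier_mat n l" and S: "S \<in> carrier_mat l l" and X: "X \<in> carrier_mat n n"
  shows "trace_inner (A * S * A\<^sup>T) X =
    (\<Sum>g<l. \<Sum>h<l. S $$ (g, h) * (\<Sum>i<n. \<Sum>j<n. A $$ (i, g) * X $$ (i, j) * A $$ (j, h)))"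
proof -
  have e: "(A * S * A\<^sup>T) $$ (i, j) = (\<Sum>g<l. \<Sum>h<l. A $$ (i, g) * S $$ (g, h) * A $$ (j, h))"
    if "i < n" "j < n" for i j
  proof -
    have AS: "(A * S) $$ (i, h) = (\<Sum>g<l. A $$ (i, g) * S $$ (g, h))" if "h < l" for h
      using that \<open>i < n\<close> A S by (auto simp: scalar_prod_def atLeast0LessThan intro!: sum.cong)
    have "(B * A\<^sup>T) $$ (i, j) = (\<Sum>h<l. B $$ (i, h) * A $$ (j, h))" if "B \<in> carrier_mat n l" for B
      using that \<open>i < n\<close> \<open>j < n\<close> A by (auto simp: scalar_prod_def atLeast0LessThan intro!: sum.cong)
    from this[OF mult_carrier_mat[OF A S]]
    have "(A * S * A\<^sup>T) $$ (i, j) = (\<Sum>h<l. (\<Sum>g<l. A $$ (i, g) * S $$ (g, h)) * A $$ (j, h))"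
      using AS by simp
    also have "\<dots> = (\<Sum>h<l. \<Sum>g<l. A $$ (i, g) * S $$ (g, h) * A $$ (j, h))"
      by (simp add: sum_distrib_right)
    finally show ?thesis by (subst sum.swap)
  qed
  have "trace_inner (A * S * A\<^sup>T) X = (\<Sum>i<n. \<Sum>j<n. (A * S * A\<^sup>T) $$ (i, j) * X $$ (i, j))"
    using A S X by (intro trace_inner_eq) auto
  also have "\<dots> = (\<Sum>i<n. \<Sum>j<n. \<Sum>g<l. \<Sum>h<l. S $$ (g, h) * (A $$ (i, g) * X $$ (i, j) * A $$ (j, h)))"
    by (intro sum.cong refl) (auto simp: e sum_distrib_right intro!: sum.cong)
  also have "\<dots> = (\<Sum>g<l. \<Sum>h<l. \<Sum>i<n. \<Sum>j<n. S $$ (g, h) * (A $$ (i, g) * X $$ (i, j) * A $$ (j, h)))"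
    by (rule sum_swap4)
  finally show ?thesis by (simp add: sum_distrib_left)
qed

lemma sum_interval_shift:
  fixes f :: "nat \<Rightarrow> real"
  shows "(\<Sum>b\<in>{a..<a + w}. f b) = (\<Sum>i<w. f (a + i))"
  using sum.shift_bounds_nat_ivl[of f 0 a w] by (simp add: atLeast0LessThan add.commute)

lemma U_set_eq: "U_set n l t = {n + t * l..<n + t * l + l}"
  by (simp add: U_set_def algebra_simps)

lemma trace_inner_add:
  assumes "F \<in> carrier_mat n n" "H \<in> carrier_mat n n" "X \<in> carrier_mat n n"
  shows "trace_inner (F + H) X = trace_inner F X + trace_inner H X"
proof -
  have "F + H \<in> carrier_mat n n" using assms by simp
  then have "trace_inner (F + H) X = (\<Sum>i<n. \<Sum>j<n. F $$ (i, j) * X $$ (i, j) + H $$ (i, j) * X $$ (i, j))"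
    using assms by (subst trace_inner_eq) (auto simp: distrib_right intro!: sum.cong)
  then show ?thesis using assms by (simp add: trace_inner_eq sum.distrib)
qed

lemma trace_inner_submatrix_interval:
  assumes "F \<in> carrier_mat w w" "X \<in> carrier_mat N N" "a + w \<le> N"
  shows "trace_inner F (submatrix X {a..<a + w} {a..<a + w}) =
    (\<Sum>i<w. \<Sum>j<w. F $$ (i, j) * X $$ (a + i, a + j))"
proof -
  have "submatrix X {a..<a + w} {a..<a + w} = mat w w (\<lambda>(i, j). X $$ (a + i, a + j))"
    using assms by (intro submatrix_interval)
  then show ?thesis using assms(1) by (auto simp: trace_inner_eq intro!: sum.cong)
qed

lemma bilin_restrict:
  assumes "X \<in> carrier_mat N N" "n \<le> N"
  shows "bilin (submatrix X {0..<n} {0..<n}) n v v =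
    bilin X N (\<lambda>i. if i < n then v i else 0) (\<lambda>i. if i < n then v i else 0)"
proof -
  have "submatrix X {0..<n} {0..<n} = mat n n (\<lambda>(i, j). X $$ (i, j))"
    using submatrix_interval[of X N 0 n] assms by simp
  then have "bilin (submatrix X {0..<n} {0..<n}) n v v =
      (\<Sum>i\<in>{..<n}. \<Sum>j\<in>{..<n}. (if i < n then v i else 0) * X $$ (i, j) * (if j < n then v j else 0))"
    by (auto simp: bilin_def intro!: sum.cong)
  also have "\<dots> = bilin X N (\<lambda>i. if i < n then v i else 0) (\<lambda>i. if i < n then v i else 0)"
    unfolding bilin_def using assms by (intro sum_square_cong_support) auto
  finally show ?thesis .
qed

lemma psd_submatrix:
  assumes "X \<in> psd_mats N" "n \<le> N"
  shows "submatrix X {0..<n} {0..<n} \<in> psd_mats n"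
proof -
  have X: "X \<in> carrier_mat N N" "X \<in> sym_mats N" using assms by (auto simp: psd_mats_iff sym_mats_def)
  have "submatrix X {0..<n} {0..<n} = mat n n (\<lambda>(i, j). X $$ (i, j))"
    using submatrix_interval[of X N 0 n] assms X by simp
  then have "submatrix X {0..<n} {0..<n} \<in> sym_mats n"
    using sym_mats_nth[OF X(2)] assms(2) by (intro sym_matsI) auto
  then show ?thesis using assms(1) bilin_restrict[OF X(1) assms(2)] by (simp add: psd_mats_iff)
qed

text \<open>\<open>LEAST\<close> on integers is informative only once a least element is known to
  exist. Widths are at least -1, so shifting them by one reduces this to natural numbers.\<close>

lemma treewidth_le:
  fixes T :: "nat ugraph"
  assumes "tree_decomposition G T V"
  shows "treewidth G \<le> td_width T V"
proof -
  let ?P = "\<lambda>w. \<exists>(T :: nat ugraph) V. tree_decomposition G T V \<and> w = td_width T V"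
  have lower: "-1 \<le> w" if "?P w" for w using that by (auto simp: td_width_def)
  define Q where "Q i \<longleftrightarrow> ?P (int i - 1)" for i
  have Q: "Q (nat (w + 1))" if "?P w" for w
  proof -
    have "int (nat (w + 1)) - 1 = w" using lower[OF that] by simp
    then show ?thesis using that by (simp add: Q_def)
  qed
  have P: "?P (td_width T V)" using assms by blast
  have "(LEAST w. ?P w) = int (LEAST i. Q i) - 1"
  proof (rule Least_equality)
    show "?P (int (LEAST i. Q i) - 1)" using LeastI[of Q, OF Q[OF P]] by (simp add: Q_def)
    show "int (LEAST i. Q i) - 1 \<le> w" if "?P w" for w
      using Least_le[of Q, OF Q[OF that]] lower[OF that] by simp
  qed
  also have "\<dots> \<le> td_width T V" using Least_le[of Q, OF Q[OF P]] lower[OF P] by simp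
  finally show ?thesis by (simp add: treewidth_def)
qed

section \<open>Form (E)\<close>

text \<open>The part of a tree decomposition of a graph on \<open>{0..<n}\<close> that does not
  mention edges; the edges of the graph enter only with the sparsity pattern.\<close>

locale rooted_bags = rooted_tree T r up depth
  for T :: "nat ugraph" and r up depth +
  fixes n l k :: nat and V :: "nat \<Rightarrow> nat set"
  assumes verts_eq: "verts T = {0..<k}"
    and bags_eq: "(\<Union>t\<in>verts T. V t) = {0..<n}"
    and topmost_unique: "\<And>i s t. topmost {t \<in> verts T. i \<in> V t} s \<Longrightarrow> topmost {t \<in> verts T. i \<in> V t} t \<Longrightarrow> s = t"
begin

lemma in_W_set_iff:
  assumes "t < k"
  shows "i \<in> W_set T V r t \<longleftrightarrow> topmost {t \<in> verts T. i \<in> V t} t"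
proof -
  have t: "t \<in> verts T" using assms by (simp add: verts_eq)
  show ?thesis
  proof (cases "t = r")
    case True
    then show ?thesis using t par_eq[OF t] by (simp add: W_set_def topmost_def)
  next
    case False
    then show ?thesis using t par_eq[OF t] up_in[OF t] by (simp add: W_set_def topmost_def)
  qed
qed

lemma bag_subset: "t < k \<Longrightarrow> V t \<subseteq> {0..<n}"
  unfolding bags_eq[symmetric] verts_eq by auto

lemma W_set_less: "t < k \<Longrightarrow> i \<in> W_set T V r t \<Longrightarrow> i < n"
  using bag_subset[of t] by (auto simp: W_set_def)

lemma ex1_W_set:
  assumes "i < n"
  shows "\<exists>t<k. i \<in> W_set T V r t \<and> (\<forall>s<k. i \<in> W_set T V r s \<longrightarrow> s = t)"
proof -
  have "i \<in> (\<Union>t\<in>verts T. V t)" using assms bags_eq by simp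
  then obtain s where "s \<in> {t \<in> verts T. i \<in> V t}" by auto
  then obtain t where t: "topmost {t \<in> verts T. i \<in> V t} t"
    using ex_topmost[of "{t \<in> verts T. i \<in> V t}" s] by auto
  then have "t < k" by (auto simp: topmost_def verts_eq)
  then show ?thesis using t in_W_set_iff topmost_unique by blast
qed

definition node_of :: "nat \<Rightarrow> nat" where
  "node_of i = (SOME t. t < k \<and> i \<in> W_set T V r t)"

lemma node_of:
  assumes "i < n" "t < k"
  shows "i \<in> W_set T V r t \<longleftrightarrow> t = node_of i"
proof -
  obtain s where s: "s < k" "i \<in> W_set T V r s" "\<forall>t<k. i \<in> W_set T V r t \<longrightarrow> t = s"
    using ex1_W_set[OF assms(1)] by blast
  then have "node_of i = s" unfolding node_of_def by (intro some_equality) blast+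
  then show ?thesis using s assms(2) by metis
qed

lemma node_of_less:
  assumes "i < n"
  shows "node_of i < k"
proof -
  obtain t where "t < k" "i \<in> W_set T V r t" using ex1_W_set[OF assms] by auto
  then show ?thesis using node_of[OF assms] by simp
qed

lemma block_index_eq:
  assumes "g < l" "h < l"
  shows "n + s * l + g = n + t * l + h \<longleftrightarrow> s = t \<and> g = h"
proof
  assume "n + s * l + g = n + t * l + h"
  then have *: "g + s * l = h + t * l" by simp
  then have "(g + s * l) div l = (h + t * l) div l" by simp
  then have "s = t" using assms by simp
  then show "s = t \<and> g = h" using * by simp
qed simp

lemma block_index_less:
  assumes "s < k" "g < l"
  shows "n + s * l + g < n + k * l"
proof -
  have "s * l + g < Suc s * l" using assms by simp
  also have "\<dots> \<le> k * l" using assms by (intro mult_le_mono1) simp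
  finally show ?thesis by simp
qed

lemma index_cases:
  assumes "b < n + k * l"
  obtains "b < n" | s g where "s < k" "g < l" "b = n + s * l + g"
proof (cases "b < n")
  case False
  then have "b - n < k * l" using assms by simp
  then have "(b - n) div l < k" "0 < l" by (auto simp: less_mult_imp_div_less intro: gr0I)
  moreover have "b = n + (b - n) div l * l + (b - n) mod l" using False by simp
  ultimately show ?thesis using that(2) by (metis mod_less_divisor)
qed (use that in blast)

section \<open>The coefficient vectors of the chain constraints\<close>

lemma a_ext_low:
  assumes "b < n" "t < k"
  shows "a_ext n l T V r A h t b = of_bool (t = node_of b) * A $$ (b, h)"
proof -
  have "b \<noteq> n + j * l + h" for j using assms(1) by simp
  then show ?thesis unfolding a_ext_def node_of[OF assms] by simp
qed

text \<open>The cases of \<open>a_ext\<close> do not compete here: an index of a block lies in no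
  \<open>W_set\<close>, and a node is not its own parent.\<close>

lemma a_ext_high:
  assumes "t < k" "s < k" "g < l" "h < l"
  shows "a_ext n l T V r A h t (n + s * l + g) =
    of_bool (g = h) * (of_bool (s \<noteq> r \<and> up s = t) - of_bool (s = t))"
proof -
  have 1: "n + s * l + g \<notin> W_set T V r t"
    using W_set_less[OF assms(1), of "n + s * l + g"] by auto
  have 2: "(\<exists>j\<in>chd T r t. n + s * l + g = n + j * l + h) \<longleftrightarrow> g = h \<and> s \<noteq> r \<and> up s = t"
    using assms by (auto simp: chd_eq block_index_eq verts_eq)
  have 3: "n + s * l + g = n + t * l + h \<longleftrightarrow> s = t \<and> g = h"
    using assms by (simp add: block_index_eq)
  have 4: "\<not> (s \<noteq> r \<and> up s = t \<and> s = t)" using up_neq[of s] assms by (auto simp: verts_eq)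
  show ?thesis unfolding a_ext_def 2 3 using 1 4 by auto
qed

text \<open>
  The vectors of the chain of constraints telescope along the tree: each \<open>U\<^sub>s\<close> other than the
  root's occurs once with sign \<open>+1\<close>, at the parent of \<open>s\<close>, and once with sign \<open>-1\<close>, at \<open>s\<close>.
\<close>

lemma sum_a_ext:
  assumes h: "h < l" and b: "b < n + k * l"
  shows "(\<Sum>t<k. a_ext n l T V r A h t b) =
    (if b < n then A $$ (b, h) else 0) - of_bool (b = n + r * l + h)"
  using b
proof (cases rule: index_cases)
  case 1
  then have "(\<Sum>t<k. a_ext n l T V r A h t b) = (\<Sum>t<k. of_bool (t = node_of b) * A $$ (b, h))"
    by (intro sum.cong) (auto simp: a_ext_low)
  then show ?thesis using 1 node_of_less[OF 1] by (simp add: sum_of_bool_left)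
next
  case (2 s g)
  have s: "s \<noteq> r \<Longrightarrow> up s < k" using up_in[of s] 2 by (auto simp: verts_eq)
  have r: "r < k" using root_in by (simp add: verts_eq)
  have "(\<Sum>t<k. a_ext n l T V r A h t b) =
      (\<Sum>t<k. of_bool (g = h) * (of_bool (s \<noteq> r \<and> up s = t) - of_bool (s = t)))"
    using 2 h by (intro sum.cong) (auto simp: a_ext_high)
  also have "\<dots> = of_bool (g = h) *
      (of_bool (s \<noteq> r) * (\<Sum>t<k. of_bool (t = up s) * 1) - (\<Sum>t<k. of_bool (t = s) * 1))"
    unfolding sum_distrib_left sum_subtractf[symmetric] by (intro sum.cong) auto
  also have "\<dots> = - of_bool (g = h \<and> s = r)"
    using s 2 sum_of_bool_left[of "up s" k "\<lambda>_. 1"] sum_of_bool_left[of s k "\<lambda>_. 1"]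
    by (cases "s = r") (auto simp del: of_bool_eq_iff)
  finally show ?thesis using 2 h r by (auto simp: block_index_eq)
qed

text \<open>Row \<open>(s, g)\<close> of the lift is the part of the column \<open>g\<close> of \<open>A\<close> introduced below \<open>s\<close>.\<close>

definition lift :: "real mat \<Rightarrow> nat \<Rightarrow> nat \<Rightarrow> real" where
  "lift A b i = (if b < n then of_bool (b = i)
    else of_bool ((node_of i, (b - n) div l) \<in> anc\<^sup>*) * A $$ (i, (b - n) mod l))"

lemma lift_high: "g < l \<Longrightarrow> lift A (n + s * l + g) i = of_bool ((node_of i, s) \<in> anc\<^sup>*) * A $$ (i, g)"
  by (simp add: lift_def)

text \<open>\<open>anc\<close> is the graph of a partial function, so the ancestors of a node form a
  chain.\<close>

lemma anc_linear: "(s, t) \<in> anc\<^sup>* \<Longrightarrow> (s, u) \<in> anc\<^sup>* \<Longrightarrow> (t, u) \<in> anc\<^sup>* \<or> (u, t) \<in> anc\<^sup>*"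
proof (induction rule: rtrancl_induct)
  case (step y z)
  show ?case
  proof (cases "(y, u) \<in> anc\<^sup>*")
    case True
    then show ?thesis
    proof (cases rule: converse_rtranclE)
      case base
      then show ?thesis using step.hyps(2) by blast
    next
      case (step w)
      then have "w = z" using \<open>(y, z) \<in> anc\<close> by (auto simp: anc_def)
      then show ?thesis using step(2) by simp
    qed
  next
    case False
    then have "(u, y) \<in> anc\<^sup>*" using step.IH step.prems by blast
    then show ?thesis using step.hyps(2) by (meson rtrancl.rtrancl_into_rtrancl)
  qed
qed simp

text \<open>The chain of ancestors from \<open>u\<close> meets at most one child of
  \<open>t\<close>, and it meets one exactly if \<open>u\<close> lies strictly below
  \<open>t\<close>.\<close>

lemma sum_anc_children:
  assumes "u < k" "t < k"
  shows "(\<Sum>s<k. of_bool (s \<noteq> r \<and> up s = t) * of_bool ((u, s) \<in> anc\<^sup>*)) =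
    (of_bool ((u, t) \<in> anc\<^sup>*) - of_bool (t = u) :: real)"
proof (cases "\<exists>s<k. s \<noteq> r \<and> up s = t \<and> (u, s) \<in> anc\<^sup>*")
  case True
  then obtain s where s: "s < k" "s \<noteq> r" "up s = t" "(u, s) \<in> anc\<^sup>*" by blast
  have st: "(s, t) \<in> anc" using s by (auto simp: anc_def verts_eq)
  have uniq: "s' = s" if "s' < k" "s' \<noteq> r" "up s' = t" "(u, s') \<in> anc\<^sup>*" for s'
  proof -
    have "depth t < depth s" using depth_up[of s] s by (simp add: verts_eq)
    moreover have "depth t < depth s'" using depth_up[of s'] that by (simp add: verts_eq)
    \<comment> \<open>A proper ancestor of a child of \<open>t\<close> is \<open>t\<close> or an
      ancestor of \<open>t\<close>, so of two comparable children neither is a proper ancestor of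
      the other.\<close>
    moreover have "x = y" if "(x, y) \<in> anc\<^sup>*" "up x = t" "depth t < depth y" for x y
      using that(1)
    proof (cases rule: converse_rtranclE)
      case (step z)
      then have "(t, y) \<in> anc\<^sup>*" using that by (auto simp: anc_def)
      then show ?thesis using anc_depth[of t y] that by auto
    qed
    ultimately show ?thesis using anc_linear[OF s(4) that(4)] s that by metis
  qed
  have "(\<Sum>s'<k. of_bool (s' \<noteq> r \<and> up s' = t) * of_bool ((u, s') \<in> anc\<^sup>*)) =
      (\<Sum>s'<k. of_bool (s' = s) * (1::real))"
  proof (rule sum.cong[OF refl])
    fix s' assume "s' \<in> {..<k}"
    then have "(s' \<noteq> r \<and> up s' = t) \<and> (u, s') \<in> anc\<^sup>* \<longleftrightarrow> s' = s" using s uniq by blast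
    then show "of_bool (s' \<noteq> r \<and> up s' = t) * of_bool ((u, s') \<in> anc\<^sup>*) = of_bool (s' = s) * (1::real)"
      by (simp only: of_bool_conj[symmetric] mult_1_right)
  qed
  also have "\<dots> = 1" using s by (simp add: sum_of_bool_left)
  finally have "(\<Sum>s'<k. of_bool (s' \<noteq> r \<and> up s' = t) * of_bool ((u, s') \<in> anc\<^sup>*)) = (1::real)" .
  moreover have "(u, t) \<in> anc\<^sup>*" using s st by (auto intro: rtrancl_into_rtrancl)
  moreover have "t \<noteq> u" using anc_depth[OF s(4)] s depth_up[of s] by (auto simp: verts_eq)
  ultimately show ?thesis by simp
next
  case False
  then have "(\<Sum>s<k. of_bool (s \<noteq> r \<and> up s = t) * of_bool ((u, s) \<in> anc\<^sup>*)) = (0::real)"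
    by (intro sum.neutral) auto
  moreover have "(u, t) \<in> anc\<^sup>* \<longleftrightarrow> t = u"
  proof
    assume "(u, t) \<in> anc\<^sup>*"
    then show "t = u"
    proof (cases rule: rtranclE)
      case (step y)
      then show ?thesis using False by (auto simp: anc_def verts_eq)
    qed simp
  qed simp
  ultimately show ?thesis by simp
qed

text \<open>On the lift, the constraint of \<open>t\<close> says that the partial sum at
  \<open>t\<close> consists of what \<open>t\<close> introduces and of the partial sums of its
  children. This is how \<open>lift\<close> is built.\<close>

lemma sum_a_ext_lift:
  assumes h: "h < l" and t: "t < k" and i: "i < n"
  shows "(\<Sum>b<n + k * l. a_ext n l T V r A h t b * lift A b i) = 0"
proof -
  have "(\<Sum>b<n. a_ext n l T V r A h t b * lift A b i) = (\<Sum>b<n. (of_bool (t = node_of b) * A $$ (b, h)) * of_bool (b = i))"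
    using t by (intro sum.cong) (auto simp: a_ext_low lift_def)
  also have "\<dots> = of_bool (t = node_of i) * A $$ (i, h)" using i by (simp only: sum_of_bool_right)
  finally have 1: "(\<Sum>b<n. a_ext n l T V r A h t b * lift A b i) = of_bool (t = node_of i) * A $$ (i, h)" .
  have "(\<Sum>g<l. a_ext n l T V r A h t (n + s * l + g) * lift A (n + s * l + g) i) =
      (of_bool (s \<noteq> r \<and> up s = t) - of_bool (s = t)) * of_bool ((node_of i, s) \<in> anc\<^sup>*) * A $$ (i, h)"
    (is "?L = ?R") if "s < k" for s
  proof -
    have "?L = (\<Sum>g<l. of_bool (g = h) * ((of_bool (s \<noteq> r \<and> up s = t) - of_bool (s = t)) *
        (of_bool ((node_of i, s) \<in> anc\<^sup>*) * A $$ (i, g))))"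
      using that t h by (intro sum.cong) (auto simp: a_ext_high lift_high)
    then show ?thesis using h by (simp add: sum_of_bool_left)
  qed
  then have "(\<Sum>s<k. \<Sum>g<l. a_ext n l T V r A h t (n + s * l + g) * lift A (n + s * l + g) i) =
      (\<Sum>s<k. (of_bool (s \<noteq> r \<and> up s = t) - of_bool (s = t)) * of_bool ((node_of i, s) \<in> anc\<^sup>*) * A $$ (i, h))"
    by simp
  also have "\<dots> = ((\<Sum>s<k. of_bool (s \<noteq> r \<and> up s = t) * of_bool ((node_of i, s) \<in> anc\<^sup>*)) -
      (\<Sum>s<k. of_bool (s = t) * of_bool ((node_of i, s) \<in> anc\<^sup>*))) * A $$ (i, h)"
    unfolding sum_subtractf[symmetric] sum_distrib_right by (intro sum.cong) (auto simp: algebra_simps)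
  also have "\<dots> = - of_bool (t = node_of i) * A $$ (i, h)"
    unfolding sum_of_bool_left[OF t] sum_anc_children[OF node_of_less[OF i] t] by simp
  finally show ?thesis unfolding sum_nested_intervals 1 by simp
qed

section \<open>The enlarged bags\<close>

lemma V_ext_subset:
  assumes "t < k"
  shows "V_ext n l T V r t \<subseteq> {0..<n + k * l}"
proof -
  have U: "U_set n l s \<subseteq> {0..<n + k * l}" if "s < k" for s
  proof -
    have "(s + 1) * l \<le> k * l" using that by (intro mult_le_mono1) simp
    then show ?thesis by (auto simp: U_set_def)
  qed
  have "chd T r t \<subseteq> {0..<k}" by (auto simp: chd_eq verts_eq)
  then have "(\<Union>i\<in>chd T r t. U_set n l i) \<subseteq> {0..<n + k * l}" by (intro UN_least U) auto
  moreover have "V t \<subseteq> {0..<n + k * l}" using bag_subset[OF assms] by auto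
  ultimately show ?thesis using U[OF assms] unfolding V_ext_def by blast
qed

lemma in_U_set_iff: "g < l \<Longrightarrow> n + s * l + g \<in> U_set n l t \<longleftrightarrow> s = t"
proof
  assume g: "g < l" and "n + s * l + g \<in> U_set n l t"
  then have "t * l \<le> s * l + g" "s * l + g < (t + 1) * l" by (auto simp: U_set_def)
  then have "(s * l + g) div l = t" by (intro div_nat_eqI) (auto simp: mult.commute)
  then show "s = t" using g by simp
qed (auto simp: U_set_def)

lemma in_V_ext_high:
  assumes "t < k" "s < k" "g < l"
  shows "n + s * l + g \<in> V_ext n l T V r t \<longleftrightarrow> s = t \<or> (s \<noteq> r \<and> up s = t)"
proof -
  have "n + s * l + g \<notin> V t" using bag_subset[OF assms(1)] by auto
  then have "n + s * l + g \<in> V_ext n l T V r t \<longleftrightarrow> s = t \<or> s \<in> chd T r t"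
    using in_U_set_iff[OF assms(3)] by (simp add: V_ext_def)
  then show ?thesis using assms(2) by (simp add: chd_eq verts_eq)
qed

lemma in_V_ext_low:
  assumes "b < n"
  shows "b \<in> V_ext n l T V r t \<longleftrightarrow> b \<in> V t"
proof -
  have "b \<notin> U_set n l s" for s using assms by (simp add: U_set_def)
  then show ?thesis by (simp add: V_ext_def)
qed

lemma a_ext_outside:
  assumes "t < k" "h < l" "b \<notin> V_ext n l T V r t"
  shows "a_ext n l T V r A h t b = 0"
proof -
  have "b \<notin> W_set T V r t" using assms(3) by (auto simp: V_ext_def W_set_def)
  moreover have "b \<noteq> n + j * l + h" if "j \<in> insert t (chd T r t)" for j
    using that assms(3) in_U_set_iff[OF assms(2), of j j] by (auto simp: V_ext_def)
  ultimately show ?thesis by (auto simp: a_ext_def)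
qed

lemma sum_V_ext:
  assumes "t < k" "h < l"
  shows "(\<Sum>i\<in>V_ext n l T V r t. \<Sum>j\<in>V_ext n l T V r t.
      a_ext n l T V r A h t i * X $$ (i, j) * a_ext n l T V r A h t j) =
    bilin X (n + k * l) (a_ext n l T V r A h t) (a_ext n l T V r A h t)"
  unfolding bilin_def
proof (rule sum_square_cong_support)
  show "V_ext n l T V r t \<subseteq> {..<n + k * l}" using V_ext_subset[OF assms(1)] by auto
  fix a b assume "a \<notin> V_ext n l T V r t \<or> b \<notin> V_ext n l T V r t"
  then show "a_ext n l T V r A h t a * X $$ (a, b) * a_ext n l T V r A h t b = 0"
    using a_ext_outside[OF assms] by auto
qed simp

text \<open>Original indices lie in the same bags as before. An index of the block of
  \<open>q\<close> lies only in the bags of \<open>q\<close> and of its parent, two adjacent nodes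
  of which the parent is topmost; the block of the root lies in a single bag.\<close>

lemma tree_decomposition_V_ext:
  assumes "verts H = {0..<n + k * l}" "\<And>e. e \<in> edges H \<Longrightarrow> \<exists>t<k. e \<subseteq> V_ext n l T V r t"
  shows "tree_decomposition H T (V_ext n l T V r)"
  unfolding tree_decomposition_iff
proof (intro conjI allI impI ballI)
  show "verts H = (\<Union>t\<in>verts T. V_ext n l T V r t)"
  proof
    show "(\<Union>t\<in>verts T. V_ext n l T V r t) \<subseteq> verts H"
      unfolding assms(1) verts_eq by (intro UN_least V_ext_subset) simp
    show "verts H \<subseteq> (\<Union>t\<in>verts T. V_ext n l T V r t)"
    proof
      fix b assume "b \<in> verts H"
      then have "b < n + k * l" using assms(1) by simp
      then show "b \<in> (\<Union>t\<in>verts T. V_ext n l T V r t)"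
      proof (cases rule: index_cases)
        case 1
        then have "b \<in> (\<Union>t\<in>verts T. V t)" using bags_eq by simp
        then show ?thesis using in_V_ext_low[OF 1] by auto
      next
        case (2 s g)
        then show ?thesis using in_V_ext_high[of s s g] by (auto simp: verts_eq)
      qed
    qed
  qed
  show "\<exists>t\<in>verts T. e \<subseteq> V_ext n l T V r t" if "e \<in> edges H" for e
    using assms(2)[OF that] by (auto simp: verts_eq)
  fix b s t
  assume st: "topmost {t \<in> verts T. b \<in> V_ext n l T V r t} s" "topmost {t \<in> verts T. b \<in> V_ext n l T V r t} t"
  then have "s < k" "t < k" "b < n + k * l" using V_ext_subset[of s] by (auto simp: topmost_def verts_eq)
  from this(3) show "s = t"
  proof (cases rule: index_cases)
    case 1
    then show ?thesis using st topmost_unique[of b s t] in_V_ext_low[OF 1] by simp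
  next
    case (2 q g)
    have eq: "{t \<in> verts T. b \<in> V_ext n l T V r t} = {t. t < k \<and> (t = q \<or> (q \<noteq> r \<and> up q = t))}"
      using 2 by (auto simp: verts_eq in_V_ext_high)
    have "up q < k" if "q \<noteq> r" using up_in[of q] that 2 by (auto simp: verts_eq)
    have "u = (if q = r then r else up q)" if "topmost {t. t < k \<and> (t = q \<or> (q \<noteq> r \<and> up q = t))} u" for u
      using that \<open>q \<noteq> r \<Longrightarrow> up q < k\<close> by (auto simp: topmost_def)
    from this[OF st(1)[unfolded eq]] this[OF st(2)[unfolded eq]] show ?thesis by simp
  qed
qed

lemma card_V_ext_le: "t < k \<Longrightarrow> card (V_ext n l T V r t) \<le> card (V t) + (1 + card (chd T r t)) * l"
proof -
  have fin: "finite (chd T r t)" using finite_verts by (simp add: chd_eq)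
  have "card (V_ext n l T V r t) \<le> card (V t \<union> U_set n l t) + card (\<Union>i\<in>chd T r t. U_set n l i)"
    unfolding V_ext_def by (rule card_Un_le)
  also have "\<dots> \<le> (card (V t) + card (U_set n l t)) + (\<Sum>i\<in>chd T r t. card (U_set n l i))"
    by (intro add_mono card_Un_le card_UN_le fin)
  also have "\<dots> = card (V t) + (1 + card (chd T r t)) * l" by (simp add: U_set_def)
  finally show ?thesis .
qed

text \<open>Away from the root one neighbour is the parent. The \<open>max 1\<close> is for the
  root, whose only neighbour, if any, is a child.\<close>

lemma card_chd_le:
  assumes t: "t < k" and root: "vertex_degree T r \<le> 1"
  shows "card (chd T r t) \<le> max 1 (vertex_degree T t - 1)"
proof (cases "t = r")
  case True
  then have "chd T r t = nbrs T t" using nbrs_eq[of t] t by (simp add: chd_eq verts_eq)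
  then show ?thesis using root True by (simp add: vertex_degree_def)
next
  case False
  have "nbrs T t = insert (up t) (chd T r t)" using nbrs_eq[of t] t False by (auto simp: chd_eq verts_eq)
  moreover have "up t \<notin> chd T r t"
    using depth_up[of t] depth_up[of "up t"] t False by (auto simp: chd_eq verts_eq)
  moreover have "finite (chd T r t)" using finite_verts by (simp add: chd_eq)
  ultimately show ?thesis by (simp add: vertex_degree_def)
qed

end

section \<open>Form (E) as a semidefinite program\<close>

context rooted_bags
begin

lemma root_less: "r < k"
  using root_in by (simp add: verts_eq)

lemma root_block_le: "n + r * l + l \<le> n + k * l"
proof -
  have "Suc r * l \<le> k * l" using root_less by (intro mult_le_mono1) simp
  then show ?thesis by simp
qed

text \<open>The two blocks do not overlap, since \<open>U_set n l r\<close> has no element below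
  \<open>n\<close>.\<close>

definition block_mat :: "real mat \<Rightarrow> real mat \<Rightarrow> real mat" where
  "block_mat F H = mat (n + k * l) (n + k * l) (\<lambda>(a, b).
     if a < n \<and> b < n then F $$ (a, b)
     else if a \<in> U_set n l r \<and> b \<in> U_set n l r then H $$ (a - (n + r * l), b - (n + r * l))
     else 0)"

lemma trace_inner_block_mat:
  assumes F: "F \<in> carrier_mat n n" and H: "H \<in> carrier_mat l l" and X: "X \<in> carrier_mat (n + k * l) (n + k * l)"
  shows "trace_inner (block_mat F H) X =
    trace_inner F (submatrix X {0..<n} {0..<n}) +
    trace_inner H (submatrix X (U_set n l r) (U_set n l r))"
proof -
  let ?N = "n + k * l" and ?J = "U_set n l r" and ?j = "n + r * l"
  define f1 where "f1 a b = (if a < n \<and> b < n then F $$ (a, b) * X $$ (a, b) else 0)" for a b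
  define f2 where "f2 a b = (if a \<in> ?J \<and> b \<in> ?J then H $$ (a - ?j, b - ?j) * X $$ (a, b) else 0)" for a b
  have "trace_inner (block_mat F H) X = (\<Sum>a<?N. \<Sum>b<?N. block_mat F H $$ (a, b) * X $$ (a, b))"
    using X by (intro trace_inner_eq) (auto simp: block_mat_def)
  also have "\<dots> = (\<Sum>a<?N. \<Sum>b<?N. f1 a b + f2 a b)"
    by (intro sum.cong refl) (auto simp: block_mat_def f1_def f2_def U_set_def)
  also have "\<dots> = (\<Sum>a<?N. \<Sum>b<?N. f1 a b) + (\<Sum>a<?N. \<Sum>b<?N. f2 a b)"
    by (simp add: sum.distrib)
  also have "(\<Sum>a<?N. \<Sum>b<?N. f1 a b) = (\<Sum>a\<in>{..<n}. \<Sum>b\<in>{..<n}. f1 a b)"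
    by (rule sum_square_cong_support[symmetric]) (auto simp: f1_def)
  also have "\<dots> = trace_inner F (submatrix X {0..<0 + n} {0..<0 + n})"
    using F X by (subst trace_inner_submatrix_interval[of _ _ _ ?N]) (auto simp: f1_def)
  also have "(\<Sum>a<?N. \<Sum>b<?N. f2 a b) = (\<Sum>a\<in>?J. \<Sum>b\<in>?J. f2 a b)"
    using root_block_le by (intro sum_square_cong_support[symmetric]) (auto simp: f2_def U_set_eq)
  also have "\<dots> = (\<Sum>i<l. \<Sum>j<l. f2 (?j + i) (?j + j))"
    unfolding U_set_eq sum_interval_shift by simp
  also have "\<dots> = (\<Sum>i<l. \<Sum>j<l. H $$ (i, j) * X $$ (?j + i, ?j + j))"
    by (intro sum.cong refl) (auto simp: f2_def U_set_eq)
  also have "\<dots> = trace_inner H (submatrix X ?J ?J)"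
    unfolding U_set_eq using H X root_block_le
    by (subst trace_inner_submatrix_interval[of _ _ _ ?N]) auto
  finally show ?thesis by simp
qed

text \<open>Division with remainder inverts the numbering \<open>m + t * l + h + 1\<close> of the
  chain constraints. Their coefficient matrices are outer products of \<open>a_ext\<close> with
  itself, which are supported on \<open>V_ext\<close> because \<open>a_ext\<close> is.\<close>

definition form_E :: "sdp \<Rightarrow> (nat \<Rightarrow> real mat) \<Rightarrow> real mat \<Rightarrow> (nat \<Rightarrow> real mat) \<Rightarrow> sdp" where
  "form_E P As A S =
    \<lparr>sdp_dim = n + k * l, sdp_ncons = sdp_ncons P + k * l,
     sdp_mat = (\<lambda>c. if c \<le> sdp_ncons P then block_mat (As c) (S c)
       else let t = (c - sdp_ncons P - 1) div l; h = (c - sdp_ncons P - 1) mod l in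
         mat (n + k * l) (n + k * l) (\<lambda>(a, b). a_ext n l T V r A h t a * a_ext n l T V r A h t b)),
     sdp_lower = (\<lambda>c. if c \<le> sdp_ncons P then sdp_lower P c else 0),
     sdp_upper = (\<lambda>c. if c \<le> sdp_ncons P then sdp_upper P c else 0)\<rparr>"

lemma constraint_cases:
  assumes "c \<in> {0..m + k * l}"
  obtains "c \<le> m" | t h where "t < k" "h < l" "c = m + t * l + h + 1"
proof (cases "c \<le> m")
  case False
  \<comment> \<open>The offset \<open>n\<close> replaces \<open>m + 1\<close> so that
    \<open>index_cases\<close> recovers \<open>t\<close> and \<open>h\<close>.\<close>
  then have "n + (c - m - 1) < n + k * l" using assms by auto
  then show ?thesis
  proof (cases rule: index_cases)
    case (2 t h)
    then show ?thesis using that(2)[of t h] False by simp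
  qed (use that(2) in simp)
qed (use that in blast)

lemma block_mat_sym:
  assumes F: "F \<in> sym_mats n" and H: "H \<in> sym_mats l"
  shows "block_mat F H \<in> sym_mats (n + k * l)"
proof (rule sym_matsI)
  fix a b assume "a < n + k * l" "b < n + k * l"
  then show "block_mat F H $$ (a, b) = block_mat F H $$ (b, a)"
    using sym_mats_nth[OF F, of a b] sym_mats_nth[OF H, of "a - (n + r * l)" "b - (n + r * l)"]
    by (auto simp: block_mat_def U_set_eq)
qed (simp add: block_mat_def)

lemma form_E_chain_mat:
  assumes "t < k" "h < l"
  shows "sdp_mat (form_E P As A S) (sdp_ncons P + t * l + h + 1) =
    mat (n + k * l) (n + k * l) (\<lambda>(a, b). a_ext n l T V r A h t a * a_ext n l T V r A h t b)"
proof -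
  have "(t * l + h) div l = t" "(t * l + h) mod l = h" using assms by simp_all
  then show ?thesis by (simp add: form_E_def Let_def)
qed

lemma is_form_E_form_E:
  assumes dim: "sdp_dim P = n"
    and As: "\<And>i. i \<le> sdp_ncons P \<Longrightarrow> As i \<in> sym_mats n" and S: "\<And>i. i \<le> sdp_ncons P \<Longrightarrow> S i \<in> sym_mats l"
  shows "is_form_E P l As A S k T V r (form_E P As A S)"
proof -
  let ?Q = "form_E P As A S" and ?N = "n + k * l" and ?m = "sdp_ncons P"
  have sym: "sdp_mat ?Q c \<in> sym_mats ?N" if "c \<in> {0..?m + k * l}" for c
    using that
  proof (cases rule: constraint_cases)
    case 1
    then show ?thesis using block_mat_sym[OF As S] by (simp add: form_E_def)
  next
    case (2 t h)
    then show ?thesis using form_E_chain_mat[of t h P As A S] by (auto intro!: sym_matsI)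
  qed
  have block: "trace_inner (sdp_mat ?Q i) X =
      trace_inner (As i) (submatrix X {0..<n} {0..<n}) +
      trace_inner (S i) (submatrix X (U_set n l r) (U_set n l r))"
    if "i \<in> {0..?m}" "X \<in> sym_mats ?N" for i X
    using that As[of i] S[of i] trace_inner_block_mat[of "As i" "S i" X]
    by (auto simp: form_E_def sym_mats_def)
  have chain: "trace_inner (sdp_mat ?Q (?m + t * l + h + 1)) X =
      (\<Sum>i\<in>V_ext n l T V r t. \<Sum>j\<in>V_ext n l T V r t.
         a_ext n l T V r A h t i * X $$ (i, j) * a_ext n l T V r A h t j)"
    if "h < l" "t < k" "X \<in> sym_mats ?N" for h t X
    unfolding sum_V_ext[OF that(2,1)] form_E_chain_mat[OF that(2,1)] bilin_def
    using that(3) by (subst trace_inner_eq[of _ ?N]) (auto simp: sym_mats_def intro!: sum.cong)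
  show ?thesis
    unfolding is_form_E_def Let_def dim
    using sym block chain by (simp add: form_E_def)
qed

text \<open>Stated for every positive semidefinite matrix on which the chain forms vanish: it serves
  for feasible points of the extension and for lifts alike, so the root block of a lift never has to
  be computed.\<close>

lemma trace_form_E:
  assumes dim: "sdp_dim P = n"
    and A: "A \<in> carrier_mat n l"
    and As: "As i \<in> carrier_mat n n" and S: "S i \<in> carrier_mat l l"
    and P: "sdp_mat P i = As i + A * S i * A\<^sup>T"
    and X: "X \<in> psd_mats (n + k * l)"
    and chain: "\<And>h t. h < l \<Longrightarrow> t < k \<Longrightarrow>
      bilin X (n + k * l) (a_ext n l T V r A h t) (a_ext n l T V r A h t) = 0"
  shows "trace_inner (As i) (submatrix X {0..<n} {0..<n}) +
      trace_inner (S i) (submatrix X (U_set n l r) (U_set n l r)) =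
    trace_inner (sdp_mat P i) (submatrix X {0..<n} {0..<n})"
proof -
  let ?N = "n + k * l" and ?j = "n + r * l"
  have XC: "X \<in> carrier_mat ?N ?N" and sym: "X \<in> sym_mats ?N"
    using X by (auto simp: psd_mats_iff sym_mats_def)
  have col: "X $$ (a, ?j + h) = (\<Sum>b<n. X $$ (a, b) * A $$ (b, h))" if a: "a < ?N" and h: "h < l" for a h
  proof -
    have "0 = (\<Sum>t<k. \<Sum>b<?N. X $$ (a, b) * a_ext n l T V r A h t b)"
      using psd_kernel[OF X chain[OF h] a] by simp
    also have "\<dots> = (\<Sum>b<?N. X $$ (a, b) * (\<Sum>t<k. a_ext n l T V r A h t b))"
      by (subst sum.swap) (simp add: sum_distrib_left)
    also have "\<dots> = (\<Sum>b<?N. X $$ (a, b) * (if b < n then A $$ (b, h) else 0) -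
        X $$ (a, b) * of_bool (b = ?j + h))"
      by (intro sum.cong) (auto simp: sum_a_ext[OF h] algebra_simps)
    also have "\<dots> = (\<Sum>b<?N. X $$ (a, b) * (if b < n then A $$ (b, h) else 0)) -
        (\<Sum>b<?N. X $$ (a, b) * of_bool (b = ?j + h))"
      by (rule sum_subtractf)
    also have "(\<Sum>b<?N. X $$ (a, b) * of_bool (b = ?j + h)) = X $$ (a, ?j + h)"
      using block_index_less[OF root_less h] by (rule sum_of_bool_right)
    also have "(\<Sum>b<?N. X $$ (a, b) * (if b < n then A $$ (b, h) else 0)) =
        (\<Sum>b<n. X $$ (a, b) * (if b < n then A $$ (b, h) else 0))"
      by (rule sum.mono_neutral_right) auto
    finally show ?thesis by simp
  qed
  \<comment> \<open>The relation \<open>col\<close> is used twice, on the columns and, through the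
    symmetry of \<open>X\<close>, on the rows.\<close>
  have XJ: "X $$ (?j + g, ?j + h) = (\<Sum>i<n. \<Sum>j<n. A $$ (i, g) * X $$ (i, j) * A $$ (j, h))"
    if g: "g < l" and h: "h < l" for g h
  proof -
    have "X $$ (?j + g, j) = (\<Sum>i<n. A $$ (i, g) * X $$ (i, j))" if "j < n" for j
    proof -
      have "X $$ (?j + g, j) = X $$ (j, ?j + g)"
        using sym_mats_nth[OF sym] block_index_less[OF root_less g] that by simp
      also have "\<dots> = (\<Sum>i<n. X $$ (j, i) * A $$ (i, g))" using col[of j g] that g by simp
      finally show ?thesis using sym_mats_nth[OF sym, of _ j] that by (simp add: mult.commute)
    qed
    then have "X $$ (?j + g, ?j + h) = (\<Sum>j<n. \<Sum>i<n. A $$ (i, g) * X $$ (i, j) * A $$ (j, h))"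
      using col[OF block_index_less[OF root_less g] h] by (simp add: sum_distrib_right)
    then show ?thesis by (subst (asm) sum.swap)
  qed
  have sub: "submatrix X {0..<n} {0..<n} = mat n n (\<lambda>(i, j). X $$ (i, j))"
    using submatrix_interval[OF XC, of 0 n] by simp
  have "trace_inner (S i) (submatrix X (U_set n l r) (U_set n l r)) =
      (\<Sum>g<l. \<Sum>h<l. S i $$ (g, h) * X $$ (?j + g, ?j + h))"
    unfolding U_set_eq using S XC root_block_le by (intro trace_inner_submatrix_interval)
  also have "\<dots> = (\<Sum>g<l. \<Sum>h<l. S i $$ (g, h) * (\<Sum>i<n. \<Sum>j<n. A $$ (i, g) * X $$ (i, j) * A $$ (j, h)))"
    by (simp add: XJ)
  also have "\<dots> = trace_inner (A * S i * A\<^sup>T) (submatrix X {0..<n} {0..<n})"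
    unfolding sub by (subst trace_inner_congruence[OF A S]) auto
  finally have 1: "trace_inner (S i) (submatrix X (U_set n l r) (U_set n l r)) =
    trace_inner (A * S i * A\<^sup>T) (submatrix X {0..<n} {0..<n})" .
  have "A * S i * A\<^sup>T \<in> carrier_mat n n" "submatrix X {0..<n} {0..<n} \<in> carrier_mat n n"
    unfolding sub using A S by auto
  then show ?thesis unfolding 1 P using As by (intro trace_inner_add[symmetric])
qed

section \<open>The lift of a feasible point\<close>

definition lift_mat :: "real mat \<Rightarrow> real mat \<Rightarrow> real mat" where
  "lift_mat A X = mat (n + k * l) (n + k * l) (\<lambda>(a, b). bilin X n (lift A a) (lift A b))"

text \<open>With \<open>M\<close> the matrix of rows \<open>lift A a\<close>, the form of
  \<open>M X M\<^sup>T\<close> at \<open>u\<close>, \<open>v\<close> is the form of \<open>X\<close>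
  at \<open>M\<^sup>T u\<close>, \<open>M\<^sup>T v\<close>. This gives semidefiniteness and, with
  \<open>sum_a_ext_lift\<close>, the chain constraints.\<close>

lemma bilin_lift_mat:
  "bilin (lift_mat A X) (n + k * l) u v =
    bilin X n (\<lambda>i. \<Sum>a<n + k * l. u a * lift A a i) (\<lambda>j. \<Sum>b<n + k * l. v b * lift A b j)"
proof -
  let ?N = "n + k * l"
  have "bilin (lift_mat A X) ?N u v = (\<Sum>a<?N. \<Sum>b<?N. \<Sum>i<n. \<Sum>j<n.
      u a * (lift A a i * X $$ (i, j) * lift A b j) * v b)"
    by (auto simp: bilin_def lift_mat_def sum_distrib_left sum_distrib_right intro!: sum.cong)
  also have "\<dots> = (\<Sum>i<n. \<Sum>j<n. \<Sum>a<?N. \<Sum>b<?N. u a * (lift A a i * X $$ (i, j) * lift A b j) * v b)"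
    by (rule sum_swap4)
  also have "\<dots> = (\<Sum>i<n. \<Sum>j<n. \<Sum>a<?N. \<Sum>b<?N. (u a * lift A a i) * X $$ (i, j) * (v b * lift A b j))"
    by (simp add: mult_ac)
  also have "\<dots> = bilin X n (\<lambda>i. \<Sum>a<?N. u a * lift A a i) (\<lambda>j. \<Sum>b<?N. v b * lift A b j)"
    unfolding bilin_def sum_distrib_right[of _ _ "X $$ _"] sum_product ..
  finally show ?thesis .
qed

lemma bilin_sym:
  assumes "X \<in> sym_mats n"
  shows "bilin X n u v = bilin X n v u"
  unfolding bilin_def
  by (subst sum.swap) (use sym_mats_nth[OF assms] in \<open>auto simp: mult_ac intro!: sum.cong\<close>)

lemma lift_mat_psd:
  assumes "X \<in> psd_mats n"
  shows "lift_mat A X \<in> psd_mats (n + k * l)"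
proof -
  have "X \<in> sym_mats n" using assms by (simp add: psd_mats_iff)
  then have "lift_mat A X \<in> sym_mats (n + k * l)"
    using bilin_sym by (intro sym_matsI) (auto simp: lift_mat_def)
  then show ?thesis using assms bilin_lift_mat by (simp add: psd_mats_iff)
qed

lemma submatrix_lift_mat:
  assumes "X \<in> carrier_mat n n"
  shows "submatrix (lift_mat A X) {0..<n} {0..<n} = X"
proof -
  have "bilin X n (lift A a) (lift A b) = X $$ (a, b)" if "a < n" "b < n" for a b
  proof -
    have "bilin X n (lift A a) (lift A b) = (\<Sum>i<n. \<Sum>j<n. of_bool (i = a) * X $$ (i, j) * of_bool (j = b))"
      unfolding bilin_def lift_def using that by (intro sum.cong) auto
    also have "\<dots> = X $$ (a, b)"
      unfolding sum_of_bool_right[OF that(2)] by (rule sum_of_bool_left[OF that(1)])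
    finally show ?thesis .
  qed
  then show ?thesis using submatrix_interval[of "lift_mat A X" "n + k * l" 0 n] assms
    by (auto simp: lift_mat_def intro!: eq_matI)
qed

text \<open>Only the description of \<open>Q\<close> by its functionals on symmetric matrices is
  used, so every problem satisfying \<open>is_form_E\<close> is covered, not just
  \<open>form_E\<close>.\<close>

lemma form_E_is_extension:
  assumes wf: "wf_sdp P" and dim: "sdp_dim P = n"
    and splr: "splr_decomposition P G l As Al" and low: "low_rank_factors P l Al A S"
    and Q: "is_form_E P l As A S k T V r Q"
  shows "is_extension Q P"
proof -
  let ?N = "n + k * l" and ?m = "sdp_ncons P"
  have Q_dim: "sdp_dim Q = ?N" "sdp_ncons Q = ?m + k * l"
    and Q_sym: "\<And>i. i \<in> {0..?m + k * l} \<Longrightarrow> sdp_mat Q i \<in> sym_mats ?N"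
    and Q_trace: "\<And>i X. i \<le> ?m \<Longrightarrow> X \<in> sym_mats ?N \<Longrightarrow>
      trace_inner (sdp_mat Q i) X = trace_inner (As i) (submatrix X {0..<n} {0..<n}) +
        trace_inner (S i) (submatrix X (U_set n l r) (U_set n l r))"
    and Q_bounds: "\<And>i. i \<in> {1..?m} \<Longrightarrow> sdp_lower Q i = sdp_lower P i \<and> sdp_upper Q i = sdp_upper P i"
    and Q_chain: "\<And>h t. h < l \<Longrightarrow> t < k \<Longrightarrow>
      sdp_lower Q (?m + t * l + h + 1) = 0 \<and> sdp_upper Q (?m + t * l + h + 1) = 0"
    and Q_chain_trace: "\<And>h t X. h < l \<Longrightarrow> t < k \<Longrightarrow> X \<in> sym_mats ?N \<Longrightarrow>
      trace_inner (sdp_mat Q (?m + t * l + h + 1)) X =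
        bilin X ?N (a_ext n l T V r A h t) (a_ext n l T V r A h t)"
    using Q sum_V_ext unfolding is_form_E_def Let_def dim by auto
  have A: "A \<in> carrier_mat n l"
    and S: "\<And>i. i \<le> ?m \<Longrightarrow> S i \<in> carrier_mat l l \<and> Al i = A * S i * A\<^sup>T"
    using low dim by (auto simp: low_rank_factors_def sym_mats_def)
  have As: "\<And>i. i \<le> ?m \<Longrightarrow> As i \<in> carrier_mat n n \<and> sdp_mat P i = As i + Al i"
    using splr dim by (auto simp: splr_decomposition_def sparse_sym_mats_def sym_mats_def)
  have trace: "trace_inner (sdp_mat Q i) X = trace_inner (sdp_mat P i) (submatrix X {0..<n} {0..<n})"
    if "i \<le> ?m" "X \<in> psd_mats ?N"
      "\<And>h t. h < l \<Longrightarrow> t < k \<Longrightarrow> bilin X ?N (a_ext n l T V r A h t) (a_ext n l T V r A h t) = 0"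
    for i X
  proof -
    have "X \<in> sym_mats ?N" using that(2) by (simp add: psd_mats_iff)
    moreover have "sdp_mat P i = As i + A * S i * A\<^sup>T" using As[OF that(1)] S[OF that(1)] by simp
    ultimately show ?thesis
      using Q_trace[OF that(1)] trace_form_E[OF dim A _ _ _ that(2,3), of As i S] As S that(1) by simp
  qed
  have "wf_sdp Q" unfolding wf_sdp_def Q_dim
  proof (intro conjI ballI)
    fix i assume i: "i \<in> {1..?m + k * l}"
    then have "i \<in> {0..?m + k * l}" by simp
    then have "sdp_lower Q i \<le> sdp_upper Q i \<and> sdp_upper Q i < \<infinity>"
    proof (cases rule: constraint_cases)
      case 1
      then show ?thesis using i Q_bounds[of i] wf by (auto simp: wf_sdp_def)
    next
      case (2 t h)
      then show ?thesis using Q_chain by simp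
    qed
    then show "sdp_lower Q i \<le> sdp_upper Q i" "sdp_upper Q i < \<infinity>" by blast+
  qed (rule Q_sym)
  moreover have "sdp_feasible P (submatrix X {0..<n} {0..<n}) \<and>
      sdp_objective Q X = sdp_objective P (submatrix X {0..<n} {0..<n})"
    if X: "sdp_feasible Q X" for X
  proof -
    have psd: "X \<in> psd_mats ?N" and bounds: "\<And>i. i \<in> {1..?m + k * l} \<Longrightarrow>
        sdp_lower Q i \<le> ereal (trace_inner (sdp_mat Q i) X) \<and>
        ereal (trace_inner (sdp_mat Q i) X) \<le> sdp_upper Q i"
      using X by (auto simp: sdp_feasible_def Q_dim)
    have zero: "bilin X ?N (a_ext n l T V r A h t) (a_ext n l T V r A h t) = 0"
      if "h < l" "t < k" for h t
    proof -
      have "n + t * l + h < n + k * l" using that by (rule_tac block_index_less)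
      then have "?m + t * l + h + 1 \<in> {1..?m + k * l}" by simp
      then have "ereal (trace_inner (sdp_mat Q (?m + t * l + h + 1)) X) = 0"
        using bounds Q_chain[OF that] by (metis antisym)
      then show ?thesis using Q_chain_trace[OF that] psd by (simp add: psd_mats_iff zero_ereal_def)
    qed
    have "submatrix X {0..<n} {0..<n} \<in> psd_mats n" using psd by (intro psd_submatrix) auto
    moreover have "sdp_lower P i \<le> ereal (trace_inner (sdp_mat P i) (submatrix X {0..<n} {0..<n})) \<and>
        ereal (trace_inner (sdp_mat P i) (submatrix X {0..<n} {0..<n})) \<le> sdp_upper P i"
      if "i \<in> {1..?m}" for i
      using that bounds[of i] Q_bounds[of i] trace[OF _ psd zero, of i] by auto
    ultimately show ?thesis using trace[OF _ psd zero, of 0]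
      by (auto simp: sdp_feasible_def sdp_objective_def dim)
  qed
  moreover have "\<exists>Y. sdp_feasible Q Y \<and> submatrix Y {0..<n} {0..<n} = X" if X: "sdp_feasible P X" for X
  proof -
    let ?Y = "lift_mat A X"
    have psd: "X \<in> psd_mats n" using X by (simp add: sdp_feasible_def dim)
    then have XC: "X \<in> carrier_mat n n" by (simp add: psd_mats_iff sym_mats_def)
    have sub: "submatrix ?Y {0..<n} {0..<n} = X" using XC by (rule submatrix_lift_mat)
    have psdY: "?Y \<in> psd_mats ?N" using psd by (rule lift_mat_psd)
    have zero: "bilin ?Y ?N (a_ext n l T V r A h t) (a_ext n l T V r A h t) = 0"
      if "h < l" "t < k" for h t
      unfolding bilin_lift_mat unfolding bilin_def using sum_a_ext_lift[OF that] by simp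
    have "sdp_lower Q i \<le> ereal (trace_inner (sdp_mat Q i) ?Y) \<and>
        ereal (trace_inner (sdp_mat Q i) ?Y) \<le> sdp_upper Q i" if i: "i \<in> {1..?m + k * l}" for i
    proof -
      have "i \<in> {0..?m + k * l}" using i by simp
      then show ?thesis
      proof (cases rule: constraint_cases)
        case 1
        then show ?thesis using i X Q_bounds[of i] trace[OF 1 psdY zero] sub
          by (auto simp: sdp_feasible_def)
      next
        case (2 t h)
        then show ?thesis using Q_chain[of h t] Q_chain_trace[of h t ?Y] zero[of h t] psdY
          by (simp add: psd_mats_iff zero_ereal_def)
      qed
    qed
    then have "sdp_feasible Q ?Y" using psdY by (simp add: sdp_feasible_def Q_dim)
    then show ?thesis using sub by blast
  qed
  ultimately show ?thesis unfolding is_extension_def Q_dim by (intro conjI exI[of _ "{0..<n}"]) auto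
qed

section \<open>Sparsity pattern and treewidth of the extension\<close>

definition bag_graph :: "nat ugraph" where
  "bag_graph = \<lparr>verts = {0..<n + k * l},
    edges = {{a, b} | a b. a \<noteq> b \<and> (\<exists>t<k. a \<in> V_ext n l T V r t \<and> b \<in> V_ext n l T V r t)}\<rparr>"

lemma tree_decomposition_bag_graph: "tree_decomposition bag_graph T (V_ext n l T V r)"
  by (rule tree_decomposition_V_ext) (auto simp: bag_graph_def)

text \<open>Every nonzero off-diagonal entry lies inside an enlarged bag: one of \<open>As c\<close>
  sits on an edge of \<open>G\<close>, which some bag contains; one of \<open>S c\<close> sits in
  the block of the root; one of a chain matrix sits in the bag of its node.\<close>

lemma form_E_sparsity:
  assumes dim: "sdp_dim P = n"
    and As: "\<And>i. i \<le> sdp_ncons P \<Longrightarrow> As i \<in> sparse_sym_mats n (edges G)"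
    and S: "\<And>i. i \<le> sdp_ncons P \<Longrightarrow> S i \<in> sym_mats l"
    and cover: "\<And>e. e \<in> edges G \<Longrightarrow> \<exists>t<k. e \<subseteq> V t"
  shows "sparsity_pattern bag_graph (form_E P As A S)"
proof -
  let ?N = "n + k * l" and ?Q = "form_E P As A S" and ?m = "sdp_ncons P"
  have form: "is_form_E P l As A S k T V r ?Q"
    using dim As S by (intro is_form_E_form_E) (auto simp: sparse_sym_mats_def)
  have sym: "sdp_mat ?Q i \<in> sym_mats ?N" if "i \<in> {0..?m + k * l}" for i
    using form that unfolding is_form_E_def Let_def dim by auto
  have simple: "simple_graph bag_graph"
    unfolding simple_graph_def
  proof (intro conjI ballI)
    fix e assume "e \<in> edges bag_graph"
    then obtain a b t where "a \<noteq> b" "t < k" "a \<in> V_ext n l T V r t" "b \<in> V_ext n l T V r t" "e = {a, b}"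
      by (auto simp: bag_graph_def)
    then show "\<exists>u\<in>verts bag_graph. \<exists>v\<in>verts bag_graph. u \<noteq> v \<and> e = {u, v}"
      using V_ext_subset[of t] by (intro bexI[of _ a] bexI[of _ b]) (auto simp: bag_graph_def)
  qed (simp add: bag_graph_def)
  have "sdp_mat ?Q c $$ (a, b) = 0"
    if c: "c \<in> {0..?m + k * l}" and ab: "a < ?N" "b < ?N" "a \<noteq> b" "{a, b} \<notin> edges bag_graph" for a b c
  proof -
    have not_bag: "\<not> (a \<in> V_ext n l T V r t \<and> b \<in> V_ext n l T V r t)" if "t < k" for t
      using ab that unfolding bag_graph_def by auto
    from c show ?thesis
    proof (cases rule: constraint_cases)
      case 1
      have "As c $$ (a, b) = 0" if "a < n" "b < n"
      proof -
        have "{a, b} \<notin> edges G"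
        proof
          assume "{a, b} \<in> edges G"
          then obtain t where "t < k" "{a, b} \<subseteq> V t" using cover by blast
          then show False using not_bag[of t] by (auto simp: V_ext_def)
        qed
        then show ?thesis using As[OF 1] that ab by (simp add: sparse_sym_mats_def)
      qed
      moreover have "\<not> (a \<in> U_set n l r \<and> b \<in> U_set n l r)"
        using not_bag[OF root_less] by (auto simp: V_ext_def)
      ultimately show ?thesis using 1 ab by (auto simp: form_E_def block_mat_def)
    next
      case (2 t h)
      then show ?thesis
        using not_bag[of t] a_ext_outside[of t h] ab form_E_chain_mat[of t h P As A S] by auto
    qed
  qed
  then show ?thesis using simple sym
    unfolding sparsity_pattern_def sparse_sym_mats_def by (auto simp: form_E_def bag_graph_def)
qed

text \<open>\<open>d\<close> bounds the number of children, so a bag gains at most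
  \<open>1 + d\<close> blocks of size \<open>l\<close>. The condition \<open>1 \<le> d\<close>
  allows for the child of a root of degree 1, where no neighbour is a parent.\<close>

lemma treewidth_bag_graph_le:
  assumes width: "\<And>t. t < k \<Longrightarrow> int (card (V t)) \<le> w + 1"
    and root: "vertex_degree T r \<le> 1" and deg: "\<And>t. t < k \<Longrightarrow> vertex_degree T t \<le> Suc d" and "1 \<le> d"
  shows "treewidth bag_graph \<le> w + int ((1 + d) * l)"
proof -
  have "int (card (V_ext n l T V r t)) \<le> w + 1 + int ((1 + d) * l)" if t: "t < k" for t
  proof -
    have "card (chd T r t) \<le> d" using card_chd_le[OF t root] deg[OF t] \<open>1 \<le> d\<close> by simp
    then have "(1 + card (chd T r t)) * l \<le> (1 + d) * l" by (intro mult_le_mono1) simp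
    then have "card (V_ext n l T V r t) \<le> card (V t) + (1 + d) * l" using card_V_ext_le[OF t] by linarith
    then show ?thesis using width[OF t] by linarith
  qed
  moreover have "Max ((\<lambda>t. card (V_ext n l T V r t)) ` verts T) \<in> (\<lambda>t. card (V_ext n l T V r t)) ` verts T"
    using finite_verts root_in by (intro Max_in) auto
  ultimately have "td_width T (V_ext n l T V r) \<le> w + int ((1 + d) * l)"
    unfolding td_width_def by (fastforce simp: verts_eq)
  then show ?thesis using treewidth_le[OF tree_decomposition_bag_graph] by linarith
qed

end

theorem theorem1p4:
  fixes n l p :: nat
    and G :: "nat ugraph"
    and P :: sdp
    and T :: "'t ugraph"
    and V :: "'t \<Rightarrow> nat set"
  assumes "simple_graph G" and "verts G = {0..<n}"
    and "wf_sdp P" and "sdp_dim P = n"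
    and "has_splr P G l"
    and "tree_decomposition G T V"
    and "card (verts T) = p"
    and "td_width T V = treewidth G"
  shows "\<exists>Q G'.
    is_extension Q P \<and>
    (\<exists>As Al A S k T' V' r.
       splr_decomposition P G l As Al \<and>
       low_rank_factors P l Al A S \<and>
       binary_splitting T V k T' V' \<and>
       admissible_root T' k r \<and>
       is_form_E P l As A S k T' V' r Q) \<and>
    sparsity_pattern G' Q \<and>
    sdp_dim Q \<le> n + 2 * p * l \<and>
    treewidth G' \<le> treewidth G + 3 * int l \<and>
    (path_graph T \<and> treewidth G = pathwidth G \<longrightarrow>
       sdp_dim Q \<le> n + p * l \<and> treewidth G' \<le> treewidth G + 2 * int l)"
proof -
  obtain As Al where splr: "splr_decomposition P G l As Al" using assms(5) by (auto simp: has_splr_def)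
  obtain A S where low: "low_rank_factors P l Al A S" using ex_low_rank_factors[OF assms(3) splr] by blast
  obtain k T' V' where split: "binary_splitting T V k T' V'" and td: "tree_decomposition G T' V'"
    and verts: "verts T' = {0..<k}" and k: "0 < k" "k \<le> 2 * p" and bags: "V' ` verts T' = V ` verts T"
    and root: "vertex_degree T' (k - 1) \<le> 1" and binary: "is_binary T'"
    and path: "path_graph T \<Longrightarrow> k = p \<and> (\<forall>t\<in>verts T'. vertex_degree T' t \<le> 2)"
    using ex_binary_splitting[OF assms(6)] assms(7) by blast
  define r where "r = k - 1"
  have "r \<in> verts T'" using k verts by (simp add: r_def)
  then obtain up depth where "rooted_tree T' r up depth" using tree_decomposition_rooted[OF td] by blast
  then interpret R: rooted_tree T' r up depth .
  interpret B: rooted_bags T' r up depth n l k V'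
  proof
    show "(\<Union>t\<in>verts T'. V' t) = {0..<n}" "\<And>i s t. R.topmost {t \<in> verts T'. i \<in> V' t} s \<Longrightarrow>
        R.topmost {t \<in> verts T'. i \<in> V' t} t \<Longrightarrow> s = t"
      using td assms(2) unfolding R.tree_decomposition_iff by (metis, blast)
  qed (rule verts)
  have S: "S i \<in> sym_mats l" and As: "As i \<in> sparse_sym_mats n (edges G)" if "i \<le> sdp_ncons P" for i
    using low splr that assms(4) by (auto simp: low_rank_factors_def splr_decomposition_def)
  let ?Q = "B.form_E P As A S"
  have form: "is_form_E P l As A S k T' V' r ?Q"
    using assms(4) As S by (intro B.is_form_E_form_E) (auto simp: sparse_sym_mats_def)
  have ext: "is_extension ?Q P" using B.form_E_is_extension[OF assms(3,4) splr low form] .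
  have sparse: "sparsity_pattern B.bag_graph ?Q"
  proof (rule B.form_E_sparsity[OF assms(4) As S])
    fix e assume "e \<in> edges G"
    then have "\<exists>t\<in>verts T'. e \<subseteq> V' t" using td unfolding tree_decomposition_def by blast
    then show "\<exists>t<k. e \<subseteq> V' t" by (auto simp: verts)
  qed
  \<comment> \<open>A leaf meets both demands on the root, whether or not \<open>T'\<close> is a
    path.\<close>
  have adm: "admissible_root T' k r" using k root by (simp add: admissible_root_def r_def)
  have dim: "sdp_dim ?Q = n + k * l" by (simp add: B.form_E_def)
  have width: "int (card (V' t)) \<le> treewidth G + 1" if "t < k" for t
  proof -
    \<comment> \<open>Splitting and relabelling repeat or rename bags but create no new ones, so the
      width is unchanged.\<close>
    have "(\<lambda>t. card (V' t)) ` verts T' = (\<lambda>t. card (V t)) ` verts T"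
      using arg_cong[OF bags, of "\<lambda>X. card ` X"] by (simp add: image_image)
    then have "int (Max ((\<lambda>t. card (V' t)) ` verts T')) = treewidth G + 1"
      using assms(8) by (simp add: td_width_def)
    moreover have "card (V' t) \<le> Max ((\<lambda>t. card (V' t)) ` verts T')"
      using that verts by (intro Max_ge) auto
    ultimately show ?thesis by linarith
  qed
  \<comment> \<open>Degrees at most 3 give \<open>d = 2\<close> and hence \<open>3 * l\<close>;
    degrees at most 2, as in the path case, give \<open>d = 1\<close> and hence
    \<open>2 * l\<close>.\<close>
  have "treewidth B.bag_graph \<le> treewidth G + int ((1 + 2) * l)"
    using binary verts by (intro B.treewidth_bag_graph_le width root[folded r_def]) (auto simp: is_binary_def)
  moreover have "treewidth B.bag_graph \<le> treewidth G + int ((1 + 1) * l)" if "path_graph T"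
    using path[OF that] verts by (intro B.treewidth_bag_graph_le width root[folded r_def]) (auto simp: numeral_2_eq_2)
  moreover have "k * l \<le> 2 * p * l" using k(2) by (rule mult_le_mono1)
  moreover have "k * l = p * l" if "path_graph T" using path[OF that] by simp
  ultimately have bounds: "sdp_dim ?Q \<le> n + 2 * p * l" "treewidth B.bag_graph \<le> treewidth G + 3 * int l"
    "path_graph T \<Longrightarrow> sdp_dim ?Q \<le> n + p * l \<and> treewidth B.bag_graph \<le> treewidth G + 2 * int l"
    by (auto simp: dim)
  show ?thesis
    using ext splr low split adm form sparse bounds by blast
qed

end
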